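(* Let $(E,A,B,C,D)$ be a descriptor system $E\dot x=Ax+B(u+w)$, $y=Cx+D(u+w)$, with $E,A$ of size $n\times n$, $B$ of size $n\times m$, $C$ of size $m\times n$, $D$ of size $m\times m$, $\det(sE-A)\not\equiv 0$, and transfer function $G(s)=C(sE-A)^{-1}B+D$. There exist $m\times m$ matrices $K$ and $L$, with $I-KD$ non-singular, such that (1) the pair $(E,\,A+B(I-KD)^{-1}KC)$ is stable, and (2) $L(I-GK)^{-1}G$ is strictly positive real (SPR), if and only if $G$ is invertible (as a rational matrix function) and the following conditions hold: (a) the finite poles of $G^{-1}$ have negative real part; (b) if $G^{-1}$ has a pole at infinity, then its order is one; (c) the uncontrollable eigenvalues and the unobservable eigenvalues of the system $(E,A,B,C,D)$ have negative real part.
   Context: Fix $\mathbb{F}\in\{\mathbb{R},\mathbb{C}\}$; all constant matrices have entries in $\mathbb{F}$. $M'$ denotes the conjugate transpose of $M$; for $M=M'$, $M>0$ means positive definite. Eigenvalues and stability of a pair: a number $\lambda\in\mathbb{C}$ is an eigenvalue of a pair $(E,F)$ of square matrices of the same size if there is a non-zero (complex) vector $v$ with $(\lambda E-F)v=0$. The pair $(E,F)$ is stable if every eigenvalue of $(E,F)$ has negative real part. Poles: $\lambda\in\mathbb{C}\cup\{\infty\}$ is a pole of a rational matrix function $H$ if $\lim_{s\to\lambda}H(s)$ does not exist (as a finite matrix). If infinity is a pole of $H$, its order is the smallest integer $l$ for which $\lim_{s\to\infty}s^{-l}H(s)$ exists. SPR: a square rational matrix function $H$ is strictly positive real if there is $\epsilon>0$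 such that $H(s)+H(s)'>0$ for every $s\in\mathbb{C}$ with $\Re(s)\ge-\epsilon$ that is not a pole of $H$. The statement that $L(I-GK)^{-1}G$ is SPR includes that $I-GK$ is invertible as a rational matrix function. Uncontrollable/unobservable eigenvalues: $\lambda\in\mathbb{C}$ is an uncontrollable eigenvalue of the system if $\begin{bmatrix}\lambda E-A & B\end{bmatrix}$ does not have maximum rank (rank $n$); it is an unobservable eigenvalue if $\begin{bmatrix}\lambda E-A\\ C\end{bmatrix}$ does not have maximum rank (rank $n$). *)

theory Defs
  imports
    "HOL-Analysis.Analysis"
    "HOL-Computational_Algebra.Computational_Algebra"
    "HOL-Computational_Algebra.Field_as_Ring"
begin

(* Constant matrices are complex; a matrix over the reals is one with entries in \<real>. *)
definition entries_in :: "complex set \<Rightarrow> complex^'n^'m \<Rightarrow> bool" where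
  "entries_in F M \<longleftrightarrow> (\<forall>i j. M $ i $ j \<in> F)"

definition conj_transpose :: "complex^'n^'m \<Rightarrow> complex^'m^'n" where
  "conj_transpose M = (\<chi> i j. cnj (M $ j $ i))"

(* For Hermitian M the form x'Mx is real, so taking the real part loses nothing. *)
definition pos_definite :: "complex^'n^'n \<Rightarrow> bool" where
  "pos_definite M \<longleftrightarrow> conj_transpose M = M \<and>
     (\<forall>x. x \<noteq> 0 \<longrightarrow> Re (\<Sum>i\<in>UNIV. cnj (x $ i) * (M *v x) $ i) > 0)"

(* The pencil sE - F, used both for complex numbers s and for the indeterminate s. *)
definition pencil :: "'a::comm_ring_1 \<Rightarrow> 'a^'n^'n \<Rightarrow> 'a^'n^'n \<Rightarrow> 'a^'n^'n" where
  "pencil s E F = (\<chi> i j. s * E $ i $ j - F $ i $ j)"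

definition pair_eigenvalue :: "complex^'n^'n \<Rightarrow> complex^'n^'n \<Rightarrow> complex \<Rightarrow> bool" where
  "pair_eigenvalue E F z \<longleftrightarrow> (\<exists>v. v \<noteq> 0 \<and> pencil z E F *v v = 0)"

definition stable_pair :: "complex^'n^'n \<Rightarrow> complex^'n^'n \<Rightarrow> bool" where
  "stable_pair E F \<longleftrightarrow> (\<forall>z. pair_eigenvalue E F z \<longrightarrow> Re z < 0)"

(* Rational functions are formal fractions of polynomials, so that det, invertible and
   matrix_inv of a matrix of them have their usual meaning over a field. *)
type_synonym ratfun = "complex poly fract"

definition rat_s :: ratfun where
  "rat_s = to_fract [:0, 1:]"

definition const_rat :: "complex^'n^'m \<Rightarrow> ratfun^'n^'m" where
  "const_rat M = map_matrix (\<lambda>c. to_fract [:c:]) M"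

(* quot_of_fract yields numerator and denominator in lowest terms, hence this is the value of r
   at every point where r has a finite limit, removable singularities included; at a pole the
   result is the meaningless 0 coming from division by zero. *)
definition rat_eval :: "ratfun \<Rightarrow> complex \<Rightarrow> complex" where
  "rat_eval r s = poly (fst (quot_of_fract r)) s / poly (snd (quot_of_fract r)) s"

definition mat_eval :: "ratfun^'n^'m \<Rightarrow> complex \<Rightarrow> complex^'n^'m" where
  "mat_eval H s = map_matrix (\<lambda>r. rat_eval r s) H"

definition finite_pole :: "ratfun^'n^'m \<Rightarrow> complex \<Rightarrow> bool" where
  "finite_pole H z \<longleftrightarrow> \<not> (\<exists>M. (mat_eval H \<longlongrightarrow> M) (at z))"

definition pole_at_infinity :: "ratfun^'n^'m \<Rightarrow> bool" where
  "pole_at_infinity H \<longleftrightarrow> \<not> (\<exists>M. (mat_eval H \<longlongrightarrow> M) at_infinity)"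

(* Only meaningful if H has a pole at infinity; e.g. for H = 0 there is no smallest l. *)
definition pole_order_infinity :: "ratfun^'n^'m \<Rightarrow> int" where
  "pole_order_infinity H =
     (LEAST l. \<exists>M. ((\<lambda>s. map_matrix (\<lambda>h. s powi (- l) * h) (mat_eval H s)) \<longlongrightarrow> M) at_infinity)"

definition strictly_positive_real :: "ratfun^'m^'m \<Rightarrow> bool" where
  "strictly_positive_real H \<longleftrightarrow> (\<exists>\<epsilon>>0. \<forall>s. Re s \<ge> - \<epsilon> \<and> \<not> finite_pole H s \<longrightarrow>
     pos_definite (mat_eval H s + conj_transpose (mat_eval H s)))"

definition transfer_function ::
  "complex^'n^'n \<Rightarrow> complex^'n^'n \<Rightarrow> complex^'m^'n \<Rightarrow> complex^'n^'m \<Rightarrow> complex^'m^'m \<Rightarrow> ratfun^'m^'m"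
  where "transfer_function E A B C D =
    const_rat C ** matrix_inv (pencil rat_s (const_rat E) (const_rat A)) ** const_rat B
      + const_rat D"

definition append_cols :: "'a^'n^'r \<Rightarrow> 'a^'m^'r \<Rightarrow> 'a^('n + 'm)^'r" where
  "append_cols M N = (\<chi> i j. case j of Inl k \<Rightarrow> M $ i $ k | Inr k \<Rightarrow> N $ i $ k)"

definition append_rows :: "'a^'n^'r \<Rightarrow> 'a^'n^'q \<Rightarrow> 'a^'n^('r + 'q)" where
  "append_rows M N = (\<chi> i. case i of Inl k \<Rightarrow> M $ k | Inr k \<Rightarrow> N $ k)"

definition uncontrollable_eigenvalue ::
  "complex^'n^'n \<Rightarrow> complex^'n^'n \<Rightarrow> complex^'m^'n \<Rightarrow> complex \<Rightarrow> bool" where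
  "uncontrollable_eigenvalue E A B z \<longleftrightarrow> rank (append_cols (pencil z E A) B) \<noteq> CARD('n)"

definition unobservable_eigenvalue ::
  "complex^'n^'n \<Rightarrow> complex^'n^'n \<Rightarrow> complex^'n^'m \<Rightarrow> complex \<Rightarrow> bool" where
  "unobservable_eigenvalue E A C z \<longleftrightarrow> rank (append_rows (pencil z E A) C) \<noteq> CARD('n)"

end

theory Submission
  imports Defs
begin

unbundle no fps_syntax

text \<open>
  Put \<open>T = L (I - G K)\<^sup>-\<^sup>1 G\<close>. Then \<open>G\<^sup>-\<^sup>1 = T\<^sup>-\<^sup>1 L + K\<close>, and \<open>x' H x\<close> has the real inner product
  \<open>inner x (H *v x)\<close> as its real part, so positivity of \<open>T(s)\<close> and of \<open>T\<^sup>-\<^sup>1(s)\<close> are equivalent.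

  Necessity: a rational function with nonnegative real part on a half-plane \<open>Re s \<ge> - \<epsilon>\<close> has
  no poles in \<open>Re s \<ge> 0\<close> and grows at most linearly; by polarization this passes from the functions
  \<open>x' T\<^sup>-\<^sup>1 x\<close> to the entries of \<open>T\<^sup>-\<^sup>1\<close>. Null vectors that witness uncontrollability or
  unobservability survive the feedback.

  Sufficiency: \<open>G\<^sup>-\<^sup>1(s) = s M + R(s)\<close> with \<open>R\<close> bounded on some \<open>Re s \<ge> - \<epsilon>\<close>. Choose an invertible \<open>N\<close>
  such that \<open>M N\<close> is positive semidefinite, \<open>L = N\<^sup>-\<^sup>1\<close> and \<open>K = - k L\<close>. Then
  \<open>T\<^sup>-\<^sup>1 = (G\<^sup>-\<^sup>1 - K) N = s M N + R N + k I\<close> has positive definite Hermitian part for large \<open>k\<close>.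
\<close>

section \<open>Evaluation of rational functions\<close>

text \<open>The inverse is the right object because the unknowns separate there:
  \<open>G^-1 = T^-1 L + K\<close> is affine in \<open>K\<close>, and \<open>L\<close> acts only as
  a factor. Linear growth is the most that a nonnegative real part tolerates. It is harmless when
  its coefficient is positive semidefinite, since \<open>Re s\<close> is at least
  \<open>- \<epsilon>\<close> and \<open>k\<close> absorbs the loss. But the leading coefficient
  \<open>M\<close> need be neither Hermitian nor invertible, only a right factor \<open>N\<close> is
  free, and over the reals \<open>N\<close> has to be real. So \<open>N\<close> is built from an
  invertible inner inverse of \<open>M\<close>, a construction that works over either field.
  Stability does not follow from positivity: eigenvalues of the closed-loop pencil may cancel in
  \<open>T\<close>, and \<open>G\<close> may have poles in the right half-plane. A separate
  perturbation argument treats them, and this is where condition (c) enters. Evaluation at a pole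
  returns a default value, so identities between rational matrices are evaluated off finite sets and
  carried to exceptional points by limits where necessary.\<close>

definition rat_regular :: "ratfun \<Rightarrow> complex \<Rightarrow> bool" where
  "rat_regular r z \<longleftrightarrow> poly (snd (quot_of_fract r)) z \<noteq> 0"

text \<open>\<open>p\<close> and \<open>q\<close> may share factors that reduction cancels. A root
  of the reduced denominator \<open>b\<close> at \<open>z\<close> would, by
  \<open>a * q = p * b\<close>, also be a root of \<open>a\<close>, against coprimality.\<close>

lemma rat_eval_Fract:
  assumes "poly q z \<noteq> 0"
  shows "rat_eval (Fract p q) z = poly p z / poly q z" and "rat_regular (Fract p q) z"
proof -
  define a b where "a = fst (quot_of_fract (Fract p q))" and "b = snd (quot_of_fract (Fract p q))"
  have b0: "b \<noteq> 0" by (simp add: b_def)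
  have q0: "q \<noteq> 0" using assms by auto
  have "Fract a b = Fract p q" by (simp add: a_def b_def)
  then have eq: "a * q = p * b" using b0 q0 by (simp add: eq_fract)
  have "coprime a b" unfolding a_def b_def by (rule coprime_quot_of_fract)
  have bz: "poly b z \<noteq> 0"
  proof
    assume "poly b z = 0"
    moreover have "poly a z * poly q z = poly p z * poly b z"
      using eq by (metis poly_mult)
    ultimately have "poly a z = 0" using assms by simp
    with \<open>poly b z = 0\<close> have "[:- z, 1:] dvd a" "[:- z, 1:] dvd b"
      by (simp_all add: poly_eq_0_iff_dvd)
    with \<open>coprime a b\<close> have "is_unit [:- z, 1:]" by (rule coprime_common_divisor)
    then show False by (simp add: is_unit_iff_degree)
  qed
  then show "rat_regular (Fract p q) z" by (simp add: rat_regular_def b_def)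
  have "poly a z * poly q z = poly p z * poly b z" using eq by (metis poly_mult)
  then show "rat_eval (Fract p q) z = poly p z / poly q z"
    using bz assms by (simp add: rat_eval_def a_def b_def field_simps)
qed

lemma ratfun_cases:
  obtains p q :: "complex poly" where "r = Fract p q" "q \<noteq> 0" "coprime p q"
    "rat_eval r = (\<lambda>s. poly p s / poly q s)" "rat_regular r = (\<lambda>s. poly q s \<noteq> 0)"
proof (rule that)
  show "r = Fract (fst (quot_of_fract r)) (snd (quot_of_fract r))" by simp
qed (auto simp: coprime_quot_of_fract rat_eval_def rat_regular_def fun_eq_iff)

lemma rat_eval_add:
  assumes "rat_regular r z" "rat_regular t z"
  shows "rat_eval (r + t) z = rat_eval r z + rat_eval t z" and "rat_regular (r + t) z"
proof -
  obtain p q where r: "r = Fract p q" "q \<noteq> 0" "rat_eval r = (\<lambda>s. poly p s / poly q s)"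
    "rat_regular r = (\<lambda>s. poly q s \<noteq> 0)" by (rule ratfun_cases)
  obtain p' q' where t: "t = Fract p' q'" "q' \<noteq> 0" "rat_eval t = (\<lambda>s. poly p' s / poly q' s)"
    "rat_regular t = (\<lambda>s. poly q' s \<noteq> 0)" by (rule ratfun_cases)
  have eq: "r + t = Fract (p * q' + p' * q) (q * q')" using r t by simp
  have nz: "poly (q * q') z \<noteq> 0" using assms r(4) t(4) by simp
  show "rat_regular (r + t) z" unfolding eq using nz by (rule rat_eval_Fract)
  show "rat_eval (r + t) z = rat_eval r z + rat_eval t z"
    unfolding eq rat_eval_Fract(1)[OF nz] r(3) t(3) using nz by (simp add: add_frac_eq)
qed

lemma rat_eval_mult:
  assumes "rat_regular r z" "rat_regular t z"
  shows "rat_eval (r * t) z = rat_eval r z * rat_eval t z" and "rat_regular (r * t) z"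
proof -
  obtain p q where r: "r = Fract p q" "q \<noteq> 0" "rat_eval r = (\<lambda>s. poly p s / poly q s)"
    "rat_regular r = (\<lambda>s. poly q s \<noteq> 0)" by (rule ratfun_cases)
  obtain p' q' where t: "t = Fract p' q'" "q' \<noteq> 0" "rat_eval t = (\<lambda>s. poly p' s / poly q' s)"
    "rat_regular t = (\<lambda>s. poly q' s \<noteq> 0)" by (rule ratfun_cases)
  have eq: "r * t = Fract (p * p') (q * q')" using r t by simp
  have nz: "poly (q * q') z \<noteq> 0" using assms r(4) t(4) by simp
  show "rat_regular (r * t) z" unfolding eq using nz by (rule rat_eval_Fract)
  show "rat_eval (r * t) z = rat_eval r z * rat_eval t z"
    unfolding eq rat_eval_Fract(1)[OF nz] r(3) t(3) by simp
qed

lemma rat_eval_const [simp]: "rat_eval (to_fract [:c:]) z = c" "rat_regular (to_fract [:c:]) z"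
  by (simp_all add: rat_eval_def rat_regular_def)

lemma rat_eval_0 [simp]: "rat_eval 0 z = 0" "rat_regular 0 z"
  by (simp_all add: rat_eval_def rat_regular_def)

lemma rat_eval_1 [simp]: "rat_eval 1 z = 1" "rat_regular 1 z"
  by (simp_all add: rat_eval_def rat_regular_def)

lemma rat_eval_rat_s [simp]: "rat_eval rat_s z = z" "rat_regular rat_s z"
  by (simp_all add: rat_eval_def rat_regular_def rat_s_def)

lemma rat_eval_uminus:
  assumes "rat_regular r z"
  shows "rat_eval (- r) z = - rat_eval r z" and "rat_regular (- r) z"
proof -
  have "to_fract [:-1:] = (- 1 :: ratfun)"
    by (metis minus_pCons minus_zero one_pCons to_fract_1 to_fract_uminus)
  then have "- r = to_fract [:-1:] * r" by simp
  with rat_eval_mult[of "to_fract [:-1:]" z r] assms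
  show "rat_eval (- r) z = - rat_eval r z" "rat_regular (- r) z" by simp_all
qed

lemma rat_eval_diff:
  assumes "rat_regular r z" "rat_regular t z"
  shows "rat_eval (r - t) z = rat_eval r z - rat_eval t z" and "rat_regular (r - t) z"
  using rat_eval_add[OF assms(1) rat_eval_uminus(2)[OF assms(2)]]
  unfolding rat_eval_uminus(1)[OF assms(2)] diff_conv_add_uminus .

lemma rat_eval_sum:
  assumes "\<And>i. i \<in> I \<Longrightarrow> rat_regular (f i) z"
  shows "rat_eval (sum f I) z = (\<Sum>i\<in>I. rat_eval (f i) z)" and "rat_regular (sum f I) z"
proof -
  have "rat_eval (sum f I) z = (\<Sum>i\<in>I. rat_eval (f i) z) \<and> rat_regular (sum f I) z"
    using assms by (induction I rule: infinite_finite_induct) (auto simp: rat_eval_add)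
  then show "rat_eval (sum f I) z = (\<Sum>i\<in>I. rat_eval (f i) z)" "rat_regular (sum f I) z" by auto
qed

lemma finite_not_rat_regular: "finite {z. \<not> rat_regular r z}"
  using poly_roots_finite[of "snd (quot_of_fract r)"] by (simp add: rat_regular_def)

lemma rat_eval_nonzero:
  assumes "r \<noteq> 0"
  shows "\<forall>\<^sub>F s in cofinite. rat_eval r s \<noteq> 0"
proof -
  obtain p q where r: "r = Fract p q" "q \<noteq> 0" "rat_eval r = (\<lambda>s. poly p s / poly q s)"
    by (rule ratfun_cases)
  have "p \<noteq> 0" using assms r(1) by (auto simp: Zero_fract_def eq_fract r(2))
  have "finite ({s. poly p s = 0} \<union> {s. poly q s = 0})"
    using \<open>p \<noteq> 0\<close> \<open>q \<noteq> 0\<close> by (simp add: poly_roots_finite)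
  moreover have "{s. \<not> rat_eval r s \<noteq> 0} = {s. poly p s = 0} \<union> {s. poly q s = 0}"
    by (auto simp: r(3))
  ultimately show ?thesis by (simp add: eventually_cofinite)
qed

lemma tendsto_rat_eval:
  assumes "rat_regular r z"
  shows "(rat_eval r \<longlongrightarrow> rat_eval r z) (at z)"
proof -
  have "isCont (\<lambda>s. poly (fst (quot_of_fract r)) s / poly (snd (quot_of_fract r)) s) z"
    using assms by (intro isCont_divide poly_isCont) (simp add: rat_regular_def)
  then show ?thesis by (simp add: isCont_def rat_eval_def[abs_def])
qed

lemma eventually_cofinite_at:
  fixes z :: "'a::t1_space"
  assumes "\<forall>\<^sub>F s in cofinite. P s"
  shows "\<forall>\<^sub>F s in at z. P s"
proof -
  have "closed ({s. \<not> P s} - {z})"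
    using assms by (intro finite_imp_closed) (simp add: eventually_cofinite)
  then have "open (- ({s. \<not> P s} - {z}))" by (rule open_Compl)
  then show ?thesis
    unfolding eventually_at_topological
    by (intro exI[of _ "- ({s. \<not> P s} - {z})"]) auto
qed

lemma eventually_cofinite_at_infinity:
  fixes P :: "'a::real_normed_vector \<Rightarrow> bool"
  assumes "\<forall>\<^sub>F s in cofinite. P s"
  shows "\<forall>\<^sub>F s in at_infinity. P s"
proof -
  have "bounded {s. \<not> P s}" using assms by (simp add: eventually_cofinite finite_imp_bounded)
  then obtain b where "\<And>s. \<not> P s \<Longrightarrow> norm s \<le> b" by (auto simp: bounded_iff)
  then show ?thesis
    unfolding eventually_at_infinity by (intro exI[of _ "b + 1"]) force
qed

text \<open>\<open>k\<close> is the pole order: the factor \<open>(s - z)^k\<close> is split off the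
  reduced denominator. The cofactor does not vanish at \<open>z\<close>, and coprimality keeps the
  numerator from vanishing there, so \<open>c \<noteq> 0\<close>.\<close>

lemma rat_pole_asymp:
  assumes "\<not> rat_regular r z"
  obtains k c where "k \<ge> 1" "c \<noteq> 0" "((\<lambda>s. rat_eval r s * (s - z) ^ k) \<longlongrightarrow> c) (at z)"
proof -
  obtain p q where r: "r = Fract p q" "q \<noteq> 0" "coprime p q"
    "rat_eval r = (\<lambda>s. poly p s / poly q s)" "rat_regular r = (\<lambda>s. poly q s \<noteq> 0)"
    by (rule ratfun_cases)
  have qz: "poly q z = 0" using assms r(5) by simp
  have pz: "poly p z \<noteq> 0"
  proof
    assume "poly p z = 0"
    with qz have "[:- z, 1:] dvd p" "[:- z, 1:] dvd q" by (simp_all add: poly_eq_0_iff_dvd)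
    with \<open>coprime p q\<close> have "is_unit [:- z, 1:]" by (rule coprime_common_divisor)
    then show False by (simp add: is_unit_iff_degree)
  qed
  obtain t where t: "q = [:- z, 1:] ^ order z q * t" "\<not> [:- z, 1:] dvd t"
    using order_decomp[OF \<open>q \<noteq> 0\<close>] by blast
  then have tz: "poly t z \<noteq> 0" by (simp add: poly_eq_0_iff_dvd)
  have qs: "poly q s = (s - z) ^ order z q * poly t s" for s
    by (subst t(1)) simp
  have "((\<lambda>s. poly p s / poly t s) \<longlongrightarrow> poly p z / poly t z) (at z)"
    using tz by (intro tendsto_intros) (auto intro: poly_isCont[unfolded isCont_def])
  moreover have "\<forall>\<^sub>F s in at z. poly p s / poly t s = rat_eval r s * (s - z) ^ order z q"
    unfolding r(4) qs by (intro eventually_mono[OF eventually_neq_at_within]) auto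
  ultimately have "((\<lambda>s. rat_eval r s * (s - z) ^ order z q) \<longlongrightarrow> poly p z / poly t z) (at z)"
    by (rule Lim_transform_eventually)
  moreover have "order z q \<ge> 1"
    using qz \<open>q \<noteq> 0\<close> order_root[of q z] by auto
  ultimately show ?thesis using pz tz by (intro that[of "order z q" "poly p z / poly t z"]) auto
qed

text \<open>Bridges the algebraic notion and the limit in the definition of a pole. A finite limit
  times \<open>(s - z)^k\<close> with \<open>k \<ge> 1\<close> gives 0, whereas the leading
  coefficient at a pole is nonzero.\<close>

lemma rat_regular_iff_tendsto: "rat_regular r z \<longleftrightarrow> (\<exists>l. (rat_eval r \<longlongrightarrow> l) (at z))"
proof
  show "\<exists>l. (rat_eval r \<longlongrightarrow> l) (at z)" if "rat_regular r z"
    using tendsto_rat_eval[OF that] by blast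
next
  assume "\<exists>l. (rat_eval r \<longlongrightarrow> l) (at z)"
  then obtain l where l: "(rat_eval r \<longlongrightarrow> l) (at z)" by blast
  show "rat_regular r z"
  proof (rule ccontr)
    assume "\<not> rat_regular r z"
    then obtain k c where kc: "k \<ge> 1" "c \<noteq> 0" "((\<lambda>s. rat_eval r s * (s - z) ^ k) \<longlongrightarrow> c) (at z)"
      by (rule rat_pole_asymp)
    have "((\<lambda>s. rat_eval r s * (s - z) ^ k) \<longlongrightarrow> l * (z - z) ^ k) (at z)"
      using l by (intro tendsto_intros)
    then have "((\<lambda>s. rat_eval r s * (s - z) ^ k) \<longlongrightarrow> 0) (at z)" using kc(1) by (simp add: power_0_left)
    then show False using kc(2,3) tendsto_unique[of "at z"] by auto
  qed
qed

section \<open>Leading terms at infinity\<close>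

lemma poly_asymp_at_infinity:
  fixes p :: "complex poly"
  shows "((\<lambda>s. poly p s / s ^ degree p) \<longlongrightarrow> lead_coeff p) at_infinity"
proof -
  have ev: "\<forall>\<^sub>F s::complex in at_infinity. s \<noteq> 0"
    using eventually_cofinite_at_infinity[of "\<lambda>s. s \<noteq> 0"] by (simp add: eventually_cofinite)
  have "((\<lambda>s. \<Sum>i\<le>degree p. coeff p i * inverse s ^ (degree p - i))
      \<longlongrightarrow> (\<Sum>i\<le>degree p. coeff p i * 0 ^ (degree p - i))) at_infinity"
    by (intro tendsto_intros tendsto_inverse_0)
  also have "(\<Sum>i\<le>degree p. coeff p i * 0 ^ (degree p - i)) =
      (\<Sum>i\<le>degree p. if i = degree p then lead_coeff p else 0)"
    by (intro sum.cong) (auto simp: power_0_left)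
  also have "\<dots> = lead_coeff p" by simp
  finally show ?thesis
  proof (rule Lim_transform_eventually)
    show "\<forall>\<^sub>F s in at_infinity. (\<Sum>i\<le>degree p. coeff p i * inverse s ^ (degree p - i)) =
        poly p s / s ^ degree p"
      using ev
    proof eventually_elim
      case (elim s)
      then show ?case
        unfolding poly_altdef sum_divide_distrib
        by (intro sum.cong) (simp_all add: power_diff power_inverse)
    qed
  qed
qed

lemma eventually_nonzero_at_infinity: "\<forall>\<^sub>F s::'a::real_normed_field in at_infinity. s \<noteq> 0"
  by (intro eventually_cofinite_at_infinity) (simp add: eventually_cofinite)

text \<open>\<open>k\<close> is the degree of the numerator minus that of the denominator; it is
  negative for a zero at infinity, hence the integer power.\<close>

lemma rat_infinity_asymp:
  assumes "r \<noteq> 0"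
  obtains k :: int and c where "c \<noteq> 0" "((\<lambda>s. s powi (- k) * rat_eval r s) \<longlongrightarrow> c) at_infinity"
proof -
  obtain p q where r: "r = Fract p q" "q \<noteq> 0" "coprime p q"
    "rat_eval r = (\<lambda>s. poly p s / poly q s)" by (rule ratfun_cases)
  have "p \<noteq> 0" using assms r(1) by (auto simp: Zero_fract_def eq_fract r(2))
  have "((\<lambda>s. (poly p s / s ^ degree p) / (poly q s / s ^ degree q))
      \<longlongrightarrow> lead_coeff p / lead_coeff q) at_infinity"
    using \<open>q \<noteq> 0\<close> by (intro tendsto_intros poly_asymp_at_infinity) auto
  then have "((\<lambda>s. s powi (- (int (degree p) - int (degree q))) * rat_eval r s)
      \<longlongrightarrow> lead_coeff p / lead_coeff q) at_infinity"
  proof (rule Lim_transform_eventually)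
    show "\<forall>\<^sub>F s in at_infinity. (poly p s / s ^ degree p) / (poly q s / s ^ degree q) =
        s powi (- (int (degree p) - int (degree q))) * rat_eval r s"
      using eventually_nonzero_at_infinity
      by eventually_elim (simp add: r(4) power_int_diff)
  qed
  then show ?thesis
    using \<open>p \<noteq> 0\<close> \<open>q \<noteq> 0\<close> by (intro that[of "lead_coeff p / lead_coeff q" "int (degree p) - int (degree q)"]) auto
qed

section \<open>Matrices\<close>

lemma matrix_inv_invertible:
  assumes "invertible M"
  shows "M ** matrix_inv M = mat 1" and "matrix_inv M ** M = mat 1"
proof -
  have "M ** matrix_inv M = mat 1 \<and> matrix_inv M ** M = mat 1"
    using assms unfolding invertible_def matrix_inv_def by (rule someI_ex)
  then show "M ** matrix_inv M = mat 1" "matrix_inv M ** M = mat 1" by auto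
qed

lemma matrix_inv_eqI:
  fixes M X :: "'a::field^'n^'n"
  assumes "M ** X = mat 1"
  shows "invertible M" and "matrix_inv M = X"
proof -
  show "invertible M" using assms invertible_right_inverse by blast
  then have "matrix_inv M = matrix_inv M ** (M ** X)" by (simp add: assms)
  also have "\<dots> = X" by (simp add: matrix_mul_assoc matrix_inv_invertible \<open>invertible M\<close>)
  finally show "matrix_inv M = X" .
qed

lemma invertible_iff_ker:
  fixes M :: "'a::field^'n^'n"
  shows "invertible M \<longleftrightarrow> (\<forall>x. M *v x = 0 \<longrightarrow> x = 0)"
  by (simp add: invertible_left_inverse matrix_left_invertible_ker)

text \<open>A basis \<open>b\<close> of the kernel is extended to a basis \<open>c\<close>; on the
  span of \<open>d = c - b\<close> the map is injective. \<open>U\<close> undoes \<open>M\<close> on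
  the basis \<open>M d\<close> of the range and matches a basis of a complement of the range with
  \<open>b\<close>, which is possible because \<open>M\<close> is square. The field is arbitrary
  since both the real and the complex case are used.\<close>

lemma ex_invertible_inner_inverse:
  fixes M :: "'a::field^'n^'n"
  shows "\<exists>U. invertible U \<and> M ** U ** M = M"
proof -
  let ?f = "(*v) M"
  have lin: "Vector_Spaces.linear (*s) (*s) ?f" by (rule matrix_vector_mul_linear_gen)
  obtain b where b: "b \<subseteq> {x. M *v x = 0}" "vec.independent b" "{x. M *v x = 0} \<subseteq> vec.span b"
    using vec.basis_exists[of "{x. M *v x = 0}"] by metis
  define c where "c = vec.extend_basis b"
  have c: "b \<subseteq> c" "vec.independent c" "vec.span c = UNIV"
    using b(2) by (simp_all add: c_def vec.extend_basis_superset vec.independent_extend_basis)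
  define d where "d = c - b"
  have ind_d: "vec.independent d" using c(2) by (rule vec.independent_mono) (auto simp: d_def)
  have "x = 0" if x: "x \<in> vec.span d" "M *v x = 0" for x
  proof -
    have xb: "x \<in> vec.span b" using b(3) x(2) by auto
    \<comment> \<open>The expansion of \<open>x\<close> in \<open>c\<close> is supported in
      \<open>b\<close> and also in the disjoint set \<open>d\<close>, so all its coefficients
      vanish.\<close>
    have "vec.representation c x = vec.representation b x"
      using vec.representation_extend[OF c(2) xb c(1)] .
    moreover have "vec.representation c x = vec.representation d x"
      using vec.representation_extend[OF c(2) x(1)] by (simp add: d_def)
    ultimately have "vec.representation b x v = 0" for v
      using vec.representation_ne_zero[of b x v] vec.representation_ne_zero[of d x v]
      by (auto simp: d_def)
    then show "x = 0" using vec.sum_nonzero_representation_eq[OF b(2) xb] by simp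
  qed
  then have inj: "inj_on ?f (vec.span d)"
    by (simp add: vec.linear_inj_on_iff_eq_0[OF lin vec.subspace_span])
  have ind_fd: "vec.independent (?f ` d)"
    using vec.linear_independent_injective_image[OF lin ind_d inj] .
  have inj_d: "inj_on ?f d" using inj by (rule inj_on_subset) (rule vec.span_superset)
  define e where "e = vec.extend_basis (?f ` d)"
  have e: "?f ` d \<subseteq> e" "vec.independent e" "vec.span e = UNIV"
    using ind_fd by (simp_all add: e_def vec.extend_basis_superset vec.independent_extend_basis)
  have fin: "finite c" "finite e" using c(2) e(2) vec.finiteI_independent by auto
  have "card c = card e"
    using vec.dim_eq_card[of c UNIV] vec.dim_eq_card[of e UNIV] c e by simp
  moreover have "card c = card b + card d"
    using fin c(1) card_mono[OF fin(1) c(1)] by (simp add: d_def card_Diff_subset finite_subset)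
  moreover have "card e = card (e - ?f ` d) + card (?f ` d)"
    using fin e(1) card_mono[OF fin(2) e(1)] by (simp add: card_Diff_subset finite_subset)
  ultimately have "card (e - ?f ` d) = card b" using card_image[OF inj_d] by simp
  then obtain \<beta> where \<beta>: "bij_betw \<beta> (e - ?f ` d) b"
    using finite_same_card_bij[of "e - ?f ` d" b] fin c(1) finite_subset by blast
  define h where "h y = (if y \<in> ?f ` d then inv_into d ?f y else \<beta> y)" for y
  obtain g where g: "Vector_Spaces.linear (*s) (*s) g" "\<And>y. y \<in> e \<Longrightarrow> g y = h y"
    using vec.linear_independent_extend[OF e(2), of h] by blast
  define U where "U = matrix g"
  have U: "U *v y = g y" for y
    unfolding U_def by (rule matrix_works[OF g(1)])
  have gd: "g (M *v x) = x" if "x \<in> d" for x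
    using that e(1) inj_d by (subst g(2)) (auto simp: h_def)
  have "c \<subseteq> range g"
  proof
    fix x assume "x \<in> c"
    show "x \<in> range g"
    proof (cases "x \<in> d")
      case True
      then show ?thesis using gd by (metis rangeI)
    next
      case False
      then have "x \<in> \<beta> ` (e - ?f ` d)" using \<beta> \<open>x \<in> c\<close> by (auto simp: d_def bij_betw_def)
      then obtain y where y: "y \<in> e" "y \<notin> ?f ` d" "x = \<beta> y" by auto
      then have "g y = x" by (simp add: g(2) h_def)
      then show ?thesis by blast
    qed
  qed
  moreover have "vec.subspace (range g)"
    using vec.linear_subspace_image[OF g(1) vec.subspace_UNIV] .
  ultimately have "vec.span c \<subseteq> range g" by (rule vec.span_minimal)
  then have "surj g" using c(3) by auto
  then have "surj ((*v) U)" by (simp add: U fun_eq_iff[of "(*v) U"] surj_def)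
  then have "invertible U"
    by (simp add: invertible_right_inverse matrix_right_invertible_surjective)
  moreover have "M ** U ** M = M"
  proof -
    have "(M ** U ** M) *v x = M *v x" for x
    proof (rule vec.linear_eq_on[of "(*v) (M ** U ** M)" "(*v) M" x c])
      fix x assume "x \<in> c"
      show "(M ** U ** M) *v x = M *v x"
      proof (cases "x \<in> d")
        case True
        then show ?thesis using gd by (simp add: U flip: matrix_vector_mul_assoc)
      next
        case False
        then have "M *v x = 0" using b(1) \<open>x \<in> c\<close> by (auto simp: d_def)
        then show ?thesis by (simp flip: matrix_vector_mul_assoc)
      qed
    qed (use c in \<open>auto intro: matrix_vector_mul_linear_gen\<close>)
    then show ?thesis by (simp add: matrix_eq)
  qed
  ultimately show ?thesis by blast
qed

text \<open>\<open>rows M\<close> is a set and forgets repeated rows, whereas right invertibility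
  concerns the indexed family. So the criterion is split into distinctness and independence of the
  rows; \<open>card (rows M) \<le> CARD('r)\<close> forces both when the rank is full.\<close>

lemma right_invertible_iff_rank:
  fixes M :: "'a::field^'n^'r"
  shows "(\<exists>X. M ** X = mat 1) \<longleftrightarrow> rank M = CARD('r)"
proof -
  have fin: "finite (rows M)" "card (rows M) \<le> CARD('r)"
    using card_image_le[of UNIV "\<lambda>i. row i M"] by (auto simp: rows_def full_SetCompr_eq)
  have "(\<exists>X. M ** X = mat 1) \<longleftrightarrow> inj (\<lambda>i. row i M) \<and> vec.independent (rows M)"
    unfolding matrix_right_invertible_independent_rows
  proof safe
    assume *: "\<forall>c. (\<Sum>i\<in>UNIV. c i *s row i M) = 0 \<longrightarrow> (\<forall>i. c i = 0)"
    show inj: "inj (\<lambda>i. row i M)"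
    proof (rule injI, rule ccontr)
      fix i j assume ij: "row i M = row j M" "i \<noteq> j"
      define c :: "'r \<Rightarrow> 'a" where "c k = (if k = i then 1 else 0) - (if k = j then 1 else 0)" for k
      have "(\<Sum>k\<in>UNIV. c k *s row k M) = (\<Sum>k\<in>UNIV. (if k = i then row k M else 0)) - (\<Sum>k\<in>UNIV. (if k = j then row k M else 0))"
        unfolding sum_subtractf[symmetric] by (intro sum.cong) (auto simp: c_def vector_sub_rdistrib)
      then have "(\<Sum>k\<in>UNIV. c k *s row k M) = 0" using ij by simp
      with * have "c i = 0" by blast
      then show False using ij by (simp add: c_def)
    qed
    show "vec.dependent (rows M) \<Longrightarrow> False"
    proof -
      have "(\<Sum>v\<in>rows M. c v *s v) = (\<Sum>i\<in>UNIV. c (row i M) *s row i M)" for c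
        using inj by (simp add: rows_def full_SetCompr_eq sum.reindex)
      then have "vec.independent (rows M)"
        unfolding vec.independent_explicit using * fin by (auto simp: rows_def)
      then show "vec.dependent (rows M) \<Longrightarrow> False" by simp
    qed
  next
    fix c i
    assume inj: "inj (\<lambda>i. row i M)" and ind: "vec.independent (rows M)"
      and 0: "(\<Sum>i\<in>UNIV. c i *s row i M) = 0"
    let ?d = "\<lambda>v. c (inv (\<lambda>i. row i M) v)"
    have "(\<Sum>v\<in>rows M. ?d v *s v) = (\<Sum>i\<in>UNIV. c i *s row i M)"
      using inj by (simp add: rows_def full_SetCompr_eq sum.reindex inv_f_f[OF inj])
    then have "(\<Sum>v\<in>rows M. ?d v *s v) = 0" by (simp only: 0)
    then have "\<forall>v\<in>rows M. ?d v = 0"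
      using ind[unfolded vec.independent_explicit, THEN conjunct2, rule_format, of ?d] by blast
    then have "?d (row i M) = 0" unfolding rows_def by blast
    then show "c i = 0" by (simp add: inv_f_f[OF inj])
  qed
  also have "\<dots> \<longleftrightarrow> rank M = CARD('r)"
  proof
    assume "inj (\<lambda>i. row i M) \<and> vec.independent (rows M)"
    then show "rank M = CARD('r)"
      by (simp add: row_rank_def_gen vec.dim_eq_card_independent rows_def full_SetCompr_eq card_image)
  next
    assume r: "rank M = CARD('r)"
    have "vec.dim (rows M) \<le> card (rows M)"
      using vec.dim_le_card[OF vec.span_superset fin(1)] .
    then have card: "card (rows M) = CARD('r)" using r fin(2) by (simp add: row_rank_def_gen)
    then have "inj (\<lambda>i. row i M)"
      by (intro eq_card_imp_inj_on) (auto simp: rows_def full_SetCompr_eq)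
    moreover have "vec.independent (rows M)"
      using r card fin(1) vec.span_superset
      by (intro vec.card_le_dim_spanning[of _ "vec.span (rows M)"]) (auto simp: row_rank_def_gen)
    ultimately show "inj (\<lambda>i. row i M) \<and> vec.independent (rows M)" ..
  qed
  finally show ?thesis .
qed

lemma left_invertible_iff_rank:
  fixes M :: "'a::field^'n^'r"
  shows "(\<exists>X. X ** M = mat 1) \<longleftrightarrow> rank M = CARD('n)"
  unfolding matrix_left_invertible_span_rows_gen row_rank_def_gen
  using vec.dim_eq_full[of "rows M"] by (simp add: vec.dimension_def card_cart_basis)

lemma sum_UNIV_Plus:
  fixes f :: "'a::finite + 'b::finite \<Rightarrow> 'c::comm_monoid_add"
  shows "sum f UNIV = (\<Sum>i\<in>UNIV. f (Inl i)) + (\<Sum>j\<in>UNIV. f (Inr j))"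
  by (simp add: sum.Plus flip: UNIV_Plus_UNIV)

text \<open>The Hautus test as a Bezout identity: \<open>X\<close> and \<open>Y\<close> are the two
  row blocks of a right inverse. In this form it adapts easily to feedback and to a perturbation of
  \<open>z\<close>.\<close>

lemma controllable_iff:
  fixes E A :: "complex^'n^'n" and B :: "complex^'m^'n"
  shows "\<not> uncontrollable_eigenvalue E A B z \<longleftrightarrow> (\<exists>X Y. pencil z E A ** X + B ** Y = mat 1)"
proof -
  have mult: "append_cols (pencil z E A) B ** Z =
      pencil z E A ** (\<chi> k. Z $ Inl k) + B ** (\<chi> k. Z $ Inr k)" for Z :: "complex^'n^('n + 'm)"
    by (simp add: matrix_matrix_mult_def append_cols_def vec_eq_iff sum_UNIV_Plus)
  have "(\<exists>Z. append_cols (pencil z E A) B ** Z = mat 1) \<longleftrightarrow>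
      (\<exists>X Y. pencil z E A ** X + B ** Y = mat 1)" (is "?l = ?r")
  proof
    assume ?r
    then obtain X Y where "pencil z E A ** X + B ** Y = mat 1" by blast
    then show ?l
      by (intro exI[of _ "\<chi> k. case k of Inl i \<Rightarrow> X $ i | Inr j \<Rightarrow> Y $ j"]) (simp add: mult)
  qed (auto simp: mult)
  then show ?thesis by (simp add: uncontrollable_eigenvalue_def right_invertible_iff_rank)
qed

lemma observable_iff:
  fixes E A :: "complex^'n^'n" and C :: "complex^'n^'m"
  shows "\<not> unobservable_eigenvalue E A C z \<longleftrightarrow> (\<forall>v. pencil z E A *v v = 0 \<longrightarrow> C *v v = 0 \<longrightarrow> v = 0)"
proof -
  have "append_rows (pencil z E A) C *v v = 0 \<longleftrightarrow> pencil z E A *v v = 0 \<and> C *v v = 0" for v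
    by (auto simp: matrix_vector_mult_def append_rows_def vec_eq_iff split: sum.splits)
  then show ?thesis
    unfolding unobservable_eigenvalue_def left_invertible_iff_rank[symmetric] matrix_left_invertible_ker
    by auto
qed

lemma pencil_mult_vec: "pencil z E A *v v = z *s (E *v v) - A *v v"
  by (simp add: pencil_def matrix_vector_mult_def vec_eq_iff left_diff_distrib sum_subtractf
      sum_distrib_left mult.assoc)

section \<open>The real inner product on complex vectors\<close>

lemma inner_complex_mult: "inner (cnj a * x) y = inner x (a * y)"
  by (simp add: inner_complex_def algebra_simps)

lemma inner_conj_transpose: "inner (conj_transpose M *v x) y = inner x (M *v y)"
proof -
  have "inner (conj_transpose M *v x) y = (\<Sum>i\<in>UNIV. \<Sum>j\<in>UNIV. inner (x $ j) (M $ j $ i * y $ i))"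
    by (simp add: inner_vec_def matrix_vector_mult_def conj_transpose_def inner_sum_left inner_complex_mult)
  also have "\<dots> = (\<Sum>j\<in>UNIV. \<Sum>i\<in>UNIV. inner (x $ j) (M $ j $ i * y $ i))"
    by (rule sum.swap)
  also have "\<dots> = inner x (M *v y)"
    by (simp add: inner_vec_def matrix_vector_mult_def inner_sum_right)
  finally show ?thesis .
qed

lemma inner_eq_Re_sum: "inner x y = Re (\<Sum>i\<in>UNIV. cnj (x $ i) * y $ i)"
  for x y :: "complex^'m"
  by (simp add: inner_vec_def inner_complex_def)

text \<open>\<open>inner\<close> is the real part of the Hermitian form, so \<open>H\<close> and its
  conjugate transpose give the same value at \<open>x\<close>, and the form of their sum is twice
  \<open>inner x (H *v x)\<close>.\<close>

lemma pos_definite_hermitian_part_iff: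
  "pos_definite (H + conj_transpose H) \<longleftrightarrow> (\<forall>x. x \<noteq> 0 \<longrightarrow> inner x (H *v x) > 0)"
proof -
  have "conj_transpose (H + conj_transpose H) = H + conj_transpose H"
    by (simp add: conj_transpose_def vec_eq_iff)
  moreover have "inner x (conj_transpose H *v x) = inner x (H *v x)" for x
    by (metis inner_commute inner_conj_transpose)
  ultimately show ?thesis
    unfolding pos_definite_def inner_eq_Re_sum[symmetric]
    by (simp add: matrix_vector_mult_add_rdistrib inner_add_right)
qed

lemma inner_smult: "inner x (c *s x) = Re c * (norm x)\<^sup>2" for x :: "complex^'m"
proof -
  have "inner z (c * z) = Re c * inner z z" for z
    by (simp add: inner_complex_def algebra_simps)
  then show ?thesis by (simp add: inner_vec_def power2_norm_eq_inner sum_distrib_left)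
qed

lemma bounded_bilinear_matrix_vector_mult:
  "bounded_bilinear ((*v) :: complex^'n^'m \<Rightarrow> complex^'n \<Rightarrow> complex^'m)"
proof (subst bilinear_conv_bounded_bilinear[symmetric], unfold bilinear_def, intro conjI allI linearI)
qed (simp_all add: vec_eq_iff matrix_vector_mult_def scaleR_sum_right
      distrib_left distrib_right sum.distrib)

lemma bounded_bilinear_matrix_mult:
  "bounded_bilinear ((**) :: complex^'n^'m \<Rightarrow> complex^'k^'n \<Rightarrow> complex^'k^'m)"
proof (subst bilinear_conv_bounded_bilinear[symmetric], unfold bilinear_def, intro conjI allI linearI)
qed (simp_all add: vec_eq_iff
      matrix_matrix_mult_def scaleR_sum_right distrib_left distrib_right sum.distrib)

lemmas tendsto_matrix_vector_mult = bounded_bilinear.tendsto[OF bounded_bilinear_matrix_vector_mult]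

lemma tendsto_matrix_iff:
  fixes f :: "'s \<Rightarrow> 'a::topological_space^'n^'m"
  shows "(f \<longlongrightarrow> M) F \<longleftrightarrow> (\<forall>i j. ((\<lambda>s. f s $ i $ j) \<longlongrightarrow> M $ i $ j) F)"
  by (auto intro: tendsto_vec_nth vec_tendstoI)

section \<open>Evaluation of rational matrices\<close>

lemma finite_pole_iff: "finite_pole H z \<longleftrightarrow> (\<exists>i j. \<not> rat_regular (H $ i $ j) z)"
proof -
  have "(\<exists>M. (mat_eval H \<longlongrightarrow> M) (at z)) \<longleftrightarrow> (\<forall>i j. rat_regular (H $ i $ j) z)"
  proof
    assume "\<forall>i j. rat_regular (H $ i $ j) z"
    then have "(mat_eval H \<longlongrightarrow> mat_eval H z) (at z)"
      by (simp add: tendsto_matrix_iff mat_eval_def tendsto_rat_eval map_matrix_def)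
    then show "\<exists>M. (mat_eval H \<longlongrightarrow> M) (at z)" ..
  qed (auto simp: tendsto_matrix_iff mat_eval_def map_matrix_def rat_regular_iff_tendsto)
  then show ?thesis by (auto simp: finite_pole_def)
qed

lemma mat_eval_nth [simp]: "mat_eval H z $ i $ j = rat_eval (H $ i $ j) z"
  by (simp add: mat_eval_def map_matrix_def)

lemma tendsto_mat_eval: "\<not> finite_pole H z \<Longrightarrow> (mat_eval H \<longlongrightarrow> mat_eval H z) (at z)"
  by (simp add: tendsto_matrix_iff tendsto_rat_eval finite_pole_iff)

lemma finite_finite_poles: "finite {z. finite_pole H z}"
proof -
  have "{z. finite_pole H z} = (\<Union>i. \<Union>j. {z. \<not> rat_regular (H $ i $ j) z})"
    by (auto simp: finite_pole_iff)
  then show ?thesis by (simp add: finite_not_rat_regular)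
qed

lemma eventually_not_finite_pole: "\<forall>\<^sub>F z in cofinite. \<not> finite_pole H z"
  by (simp add: eventually_cofinite finite_finite_poles)

lemma mat_eval_mult:
  assumes "\<not> finite_pole H z" "\<not> finite_pole J z"
  shows "mat_eval (H ** J) z = mat_eval H z ** mat_eval J z" and "\<not> finite_pole (H ** J) z"
  using assms
  by (auto simp: vec_eq_iff matrix_matrix_mult_def finite_pole_iff rat_eval_sum rat_eval_mult)

lemma mat_eval_add:
  assumes "\<not> finite_pole H z" "\<not> finite_pole J z"
  shows "mat_eval (H + J) z = mat_eval H z + mat_eval J z" and "\<not> finite_pole (H + J) z"
  using assms by (auto simp: vec_eq_iff finite_pole_iff rat_eval_add)

lemma mat_eval_diff:
  assumes "\<not> finite_pole H z" "\<not> finite_pole J z"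
  shows "mat_eval (H - J) z = mat_eval H z - mat_eval J z" and "\<not> finite_pole (H - J) z"
  using assms by (auto simp: vec_eq_iff finite_pole_iff rat_eval_diff)

lemma mat_eval_const_rat [simp]: "mat_eval (const_rat M) z = M" "\<not> finite_pole (const_rat M) z"
  by (auto simp: vec_eq_iff finite_pole_iff const_rat_def map_matrix_def)

lemma mat_eval_mat_1 [simp]: "mat_eval (mat 1) z = mat 1" "\<not> finite_pole (mat 1) z"
  by (auto simp: vec_eq_iff finite_pole_iff mat_def)

lemma mat_eval_pencil [simp]:
  "mat_eval (pencil rat_s (const_rat E) (const_rat A)) z = pencil z E A"
  "\<not> finite_pole (pencil rat_s (const_rat E) (const_rat A)) z"
  by (auto simp: vec_eq_iff finite_pole_iff pencil_def const_rat_def map_matrix_def rat_eval_mult rat_eval_diff)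

lemma const_rat_mult: "const_rat M ** const_rat N = const_rat (M ** N)"
proof -
  have "to_fract [:\<Sum>k\<in>S. M $ i $ k * N $ k $ j:] = (\<Sum>k\<in>S. to_fract [:M $ i $ k:] * to_fract [:N $ k $ j:])"
    if "finite S" for S i j
    using that
  proof induction
    case (insert k S)
    have "to_fract [:a + b:] = to_fract [:a:] + to_fract [:b:]" for a b :: complex
      by (simp flip: to_fract_add)
    with insert show ?case by (simp flip: to_fract_mult add: mult.commute)
  qed simp
  then show ?thesis
    by (simp add: const_rat_def map_matrix_def matrix_matrix_mult_def vec_eq_iff)
qed

lemma const_rat_mat_1: "const_rat (mat 1) = mat 1"
  by (simp add: const_rat_def map_matrix_def mat_def vec_eq_iff flip: one_pCons)

text \<open>A nonzero rational kernel vector evaluates to a nonzero kernel vector at all but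
  finitely many \<open>s\<close>, so invertibility at infinitely many points rules it out.\<close>

lemma invertible_ratmatI:
  fixes H :: "ratfun^'m^'m"
  assumes "\<exists>\<^sub>F s in cofinite. invertible (mat_eval H s)"
  shows "invertible H"
  unfolding invertible_iff_ker
proof (intro allI impI, rule ccontr)
  fix x assume 0: "H *v x = 0" and "x \<noteq> 0"
  then obtain k where k: "x $ k \<noteq> 0" by (auto simp: vec_eq_iff)
  define y where "y s = (\<chi> i. rat_eval (x $ i) s)" for s
  have "finite (\<Union>i. {s. \<not> rat_regular (x $ i) s})"
    by (simp add: finite_not_rat_regular)
  then have "\<forall>\<^sub>F s in cofinite. \<forall>i. rat_regular (x $ i) s"
    by (simp add: eventually_cofinite Collect_ex_eq[symmetric] UNION_eq)
  then have "\<forall>\<^sub>F s in cofinite. \<not> invertible (mat_eval H s)"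
    using eventually_not_finite_pole[of H] rat_eval_nonzero[OF k]
  proof eventually_elim
    case (elim s)
    have "(mat_eval H s *v y s) $ i = rat_eval ((H *v x) $ i) s" for i
      using elim by (simp add: y_def matrix_vector_mult_def finite_pole_iff rat_eval_sum rat_eval_mult)
    then have "mat_eval H s *v y s = 0" by (simp add: vec_eq_iff 0)
    moreover have "y s \<noteq> 0" using elim(3) by (auto simp: y_def vec_eq_iff)
    ultimately show ?case by (auto simp: invertible_iff_ker)
  qed
  then show False using assms by (simp add: frequently_def)
qed

lemma mat_eval_matrix_inv:
  fixes H :: "ratfun^'m^'m"
  assumes "invertible H"
  shows "\<forall>\<^sub>F s in cofinite. invertible (mat_eval H s) \<and>
    mat_eval (matrix_inv H) s = matrix_inv (mat_eval H s)"
  using eventually_not_finite_pole[of H] eventually_not_finite_pole[of "matrix_inv H"]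
proof eventually_elim
  case (elim s)
  have "mat_eval H s ** mat_eval (matrix_inv H) s = mat 1"
    using mat_eval_mult(1)[OF elim] by (simp add: matrix_inv_invertible assms)
  then show ?case using matrix_inv_eqI[of "mat_eval H s" "mat_eval (matrix_inv H) s"] by simp
qed

section \<open>Rational functions with nonnegative real part\<close>

lemma eventually_rat_regular: "\<forall>\<^sub>F s in cofinite. rat_regular r s"
  by (simp add: eventually_cofinite finite_not_rat_regular)

text \<open>At a pole, the values along a suitable ray tend to infinity in the direction of \<open>-1\<close>.\<close>

lemma rat_regular_if_Re_nonneg:
  assumes nonneg: "\<forall>\<^sub>F s in at z. 0 \<le> Re (rat_eval r s)"
  shows "rat_regular r z"
proof (rule ccontr)
  assume "\<not> rat_regular r z"
  then obtain k c where k: "k \<ge> 1" and c: "c \<noteq> 0"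
    and lim: "((\<lambda>s. rat_eval r s * (s - z) ^ k) \<longlongrightarrow> c) (at z)"
    by (rule rat_pole_asymp)
  \<comment> \<open>A \<open>k\<close>-th root of \<open>- c\<close>: along
    \<open>s = z + t w\<close> with real \<open>t > 0\<close>, the product \<open>r(s) * t^k\<close>
    tends to \<open>c / w^k = -1\<close>.\<close>
  define w where "w = exp (Ln (- c) / of_nat k)"
  have wk: "w ^ k = - c" using k c by (simp add: w_def exp_of_nat_mult[symmetric])
  have w0: "w \<noteq> 0" by (simp add: w_def)
  have ray: "filterlim (\<lambda>t. z + of_real t * w) (at z) (at_right 0)"
    unfolding filterlim_at
  proof
    have "((\<lambda>t. z + of_real t * w) \<longlongrightarrow> z + of_real 0 * w) (at_right 0)"
      by (intro tendsto_intros)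
    then show "((\<lambda>t. z + of_real t * w) \<longlongrightarrow> z) (at_right 0)" by simp
    show "\<forall>\<^sub>F t in at_right 0. z + complex_of_real t * w \<in> UNIV \<and> z + of_real t * w \<noteq> z"
      using eventually_at_right_less[of 0] by eventually_elim (use w0 in simp)
  qed
  have "((\<lambda>t. rat_eval r (z + of_real t * w) * (of_real t * w) ^ k) \<longlongrightarrow> c) (at_right 0)"
    using filterlim_compose[OF lim ray] by simp
  then have "((\<lambda>t. rat_eval r (z + of_real t * w) * (of_real t * w) ^ k / w ^ k) \<longlongrightarrow> c / w ^ k) (at_right 0)"
    by (intro tendsto_intros) (use w0 in auto)
  then have "((\<lambda>t. rat_eval r (z + of_real t * w) * of_real (t ^ k)) \<longlongrightarrow> -1) (at_right 0)"
    using w0 c by (simp add: wk[symmetric] power_mult_distrib) (simp add: wk)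
  then have "((\<lambda>t. Re (rat_eval r (z + of_real t * w) * of_real (t ^ k))) \<longlongrightarrow> Re (-1)) (at_right 0)"
    by (rule tendsto_Re)
  moreover have "\<forall>\<^sub>F t in at_right 0. 0 \<le> Re (rat_eval r (z + of_real t * w) * of_real (t ^ k))"
    using eventually_compose_filterlim[OF nonneg ray] eventually_at_right_less[of 0]
    by eventually_elim simp
  ultimately have "0 \<le> Re (-1)"
    by (intro tendsto_lowerbound) auto
  then show False by simp
qed

lemma tendsto_powi_at_infinity:
  assumes "j \<le> 0"
  shows "\<exists>l. ((\<lambda>s::complex. s powi j) \<longlongrightarrow> l) at_infinity"
proof -
  have "((\<lambda>s::complex. inverse s ^ nat (- j)) \<longlongrightarrow> 0 ^ nat (- j)) at_infinity"
    by (intro tendsto_intros tendsto_inverse_0)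
  moreover have "s powi j = inverse s ^ nat (- j)" for s :: complex
    using assms by (cases "j = 0") (auto simp: power_int_def)
  ultimately show ?thesis by auto
qed

text \<open>The exponents that tame \<open>f\<close> at infinity are upward closed: raising one
  multiplies by a nonpositive power of \<open>s\<close>, which converges.\<close>

lemma tendsto_powi_mult:
  assumes "((\<lambda>s. s powi (- k) * f s) \<longlongrightarrow> c) at_infinity" "k \<le> l"
  shows "\<exists>c. ((\<lambda>s::complex. s powi (- l) * f s) \<longlongrightarrow> c) at_infinity"
proof -
  obtain d where "((\<lambda>s::complex. s powi (k - l)) \<longlongrightarrow> d) at_infinity"
    using tendsto_powi_at_infinity[of "k - l"] assms(2) by auto
  from tendsto_mult[OF this assms(1)]
  have "((\<lambda>s. s powi (k - l) * (s powi (- k) * f s)) \<longlongrightarrow> d * c) at_infinity" .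
  then have "((\<lambda>s. s powi (- l) * f s) \<longlongrightarrow> d * c) at_infinity"
  proof (rule Lim_transform_eventually)
    show "\<forall>\<^sub>F s in at_infinity. s powi (k - l) * (s powi (- k) * f s) = s powi (- l) * f s"
      using eventually_nonzero_at_infinity
      by eventually_elim (simp add: power_int_add[symmetric] mult.assoc[symmetric])
  qed
  then show ?thesis by blast
qed

text \<open>If \<open>r(s)\<close> grows like \<open>c * s^k\<close> with \<open>k \<ge> 2\<close>, then the angle swept by \<open>s^k\<close> over the
  closed right half-plane is at least \<open>2 * pi\<close>, so \<open>r\<close> approaches the direction of \<open>-1\<close> there.\<close>

lemma rat_order_infinity_le_1_if_Re_nonneg:
  assumes nonneg: "\<forall>\<^sub>F s in at_infinity. 0 \<le> Re s \<longrightarrow> 0 \<le> Re (rat_eval r s)"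
  shows "\<exists>l. ((\<lambda>s. s powi (-1) * rat_eval r s) \<longlongrightarrow> l) at_infinity"
proof (cases "r = 0")
  case False
  then obtain k :: int and c where c: "c \<noteq> 0"
    and lim: "((\<lambda>s. s powi (- k) * rat_eval r s) \<longlongrightarrow> c) at_infinity"
    by (rule rat_infinity_asymp)
  have "k \<le> 1"
  proof (rule ccontr)
    assume "\<not> k \<le> 1"
    define n where "n = nat k"
    have n: "n \<ge> 2" "k = int n" using \<open>\<not> k \<le> 1\<close> by (auto simp: n_def)
    \<comment> \<open>The principal \<open>n\<close>-th root of \<open>-1 / c\<close>. Its argument
      is at most \<open>pi / n\<close> in absolute value, and \<open>n \<ge> 2\<close> puts it into
      the closed right half-plane, so the ray through \<open>w\<close> stays where nonnegativity is
      assumed.\<close>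
    define w where "w = exp (Ln (- 1 / c) / of_nat n)"
    have "exp (of_nat n * (Ln (- 1 / c) / of_nat n)) = - 1 / c" using n c by simp
    then have wn: "w ^ n = - 1 / c" unfolding w_def exp_of_nat_mult .
    have w0: "w \<noteq> 0" by (simp add: w_def)
    have "\<bar>Im (Ln (- 1 / c))\<bar> \<le> pi"
      using mpi_less_Im_Ln[of "- 1 / c"] Im_Ln_le_pi[of "- 1 / c"] c by simp
    moreover have "pi \<le> pi / 2 * real n" using n(1) by (simp add: field_simps)
    ultimately have "\<bar>Im (Ln (- 1 / c))\<bar> \<le> pi / 2 * real n" by (rule order_trans)
    then have "\<bar>Im (Ln (- 1 / c)) / real n\<bar> \<le> pi / 2"
      using n(1) by (simp only: abs_divide abs_of_nat pos_divide_le_eq of_nat_0_less_iff)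
    then have "0 \<le> cos (Im (Ln (- 1 / c)) / real n)"
      by (intro cos_ge_zero) linarith+
    then have Rew: "0 \<le> Re w" by (simp add: w_def Re_exp)
    have ray: "filterlim (\<lambda>t. of_real t * w) at_infinity at_top"
    proof -
      have "filterlim (\<lambda>t. t * norm w) at_top at_top"
        using w0 by (intro filterlim_at_top_mult_tendsto_pos[OF tendsto_const] filterlim_ident
            | simp add: mult.commute)+
      then have "filterlim (\<lambda>t. norm (of_real t * w)) at_top at_top"
        by (rule filterlim_at_top_mono) (simp add: norm_mult mult_right_mono)
      then show ?thesis by (rule filterlim_norm_at_top_imp_at_infinity)
    qed
    have "((\<lambda>t. (of_real t * w) powi (- k) * rat_eval r (of_real t * w)) \<longlongrightarrow> c) at_top"
      by (rule filterlim_compose[OF lim ray])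
    then have "((\<lambda>t. w ^ n * ((of_real t * w) powi (- k) * rat_eval r (of_real t * w)))
        \<longlongrightarrow> w ^ n * c) at_top"
      by (intro tendsto_intros)
    moreover have "w ^ n * ((of_real t * w) powi (- k) * rat_eval r (of_real t * w)) =
        of_real (inverse (t ^ n)) * rat_eval r (of_real t * w)" for t
      using w0 by (simp add: n(2) power_int_minus power_mult_distrib field_simps)
    ultimately have "((\<lambda>t. of_real (inverse (t ^ n)) * rat_eval r (of_real t * w)) \<longlongrightarrow> -1) at_top"
      using c by (simp add: wn)
    then have "((\<lambda>t. Re (of_real (inverse (t ^ n)) * rat_eval r (of_real t * w))) \<longlongrightarrow> Re (-1)) at_top"
      by (rule tendsto_Re)
    moreover have "\<forall>\<^sub>F t in at_top. 0 \<le> Re (of_real (inverse (t ^ n)) * rat_eval r (of_real t * w))"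
      using eventually_compose_filterlim[OF nonneg ray] eventually_gt_at_top[of 0]
      by eventually_elim (use Rew in simp)
    ultimately have "0 \<le> Re (-1)"
      by (intro tendsto_lowerbound) auto
    then show False by simp
  qed
  with lim show ?thesis by (rule tendsto_powi_mult)
qed (auto intro: tendsto_const)

section \<open>Growth at infinity\<close>

lemma ex_tendsto_matrix_iff:
  fixes f :: "'s \<Rightarrow> 'a::topological_space^'n^'m"
  shows "(\<exists>M. (f \<longlongrightarrow> M) F) \<longleftrightarrow> (\<forall>i j. \<exists>l. ((\<lambda>s. f s $ i $ j) \<longlongrightarrow> l) F)"
proof
  assume "\<forall>i j. \<exists>l. ((\<lambda>s. f s $ i $ j) \<longlongrightarrow> l) F"
  then obtain l where "\<And>i j. ((\<lambda>s. f s $ i $ j) \<longlongrightarrow> l i j) F" by metis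
  then have "(f \<longlongrightarrow> (\<chi> i j. l i j)) F" by (simp add: tendsto_matrix_iff)
  then show "\<exists>M. (f \<longlongrightarrow> M) F" ..
qed (auto simp: tendsto_matrix_iff)

text \<open>Admissibility \<open>P\<close> of an exponent is upward closed, and absence of a pole is
  \<open>P 0\<close>. With a pole, every admissible exponent is at least 1, so order one amounts to
  \<open>P 1\<close>. The work lies in showing that \<open>LEAST\<close> over the integers really
  picks a minimum.\<close>

lemma pole_order_infinity_le_1_iff:
  "(pole_at_infinity H \<longrightarrow> pole_order_infinity H = 1) \<longleftrightarrow>
    (\<forall>i j. \<exists>l. ((\<lambda>s. s powi (-1) * rat_eval (H $ i $ j) s) \<longlongrightarrow> l) at_infinity)"
proof -
  define P where "P l \<longleftrightarrow> (\<forall>i j. \<exists>c. ((\<lambda>s. s powi (- l) * rat_eval (H $ i $ j) s) \<longlongrightarrow> c) at_infinity)" for l :: int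
  have order: "pole_order_infinity H = (LEAST l. P l)"
    by (simp add: pole_order_infinity_def ex_tendsto_matrix_iff P_def)
  have P_mono: "P l'" if Pl: "P l" and le: "l \<le> l'" for l l'
    unfolding P_def
  proof (intro allI)
    fix i j
    obtain c where "((\<lambda>s. s powi (- l) * rat_eval (H $ i $ j) s) \<longlongrightarrow> c) at_infinity"
      using Pl unfolding P_def by blast
    then show "\<exists>c. ((\<lambda>s. s powi (- l') * rat_eval (H $ i $ j) s) \<longlongrightarrow> c) at_infinity"
      using le by (rule tendsto_powi_mult)
  qed
  have pole: "pole_at_infinity H \<longleftrightarrow> \<not> P 0"
    by (simp add: pole_at_infinity_def ex_tendsto_matrix_iff P_def)
  have "\<exists>n::nat. \<exists>c. ((\<lambda>s. s powi (- int n) * rat_eval r s) \<longlongrightarrow> c) at_infinity" for r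
  proof (cases "r = 0")
    case False
    then obtain k :: int and c where "((\<lambda>s. s powi (- k) * rat_eval r s) \<longlongrightarrow> c) at_infinity"
      by (rule rat_infinity_asymp)
    then have "\<exists>c. ((\<lambda>s. s powi (- int (nat k)) * rat_eval r s) \<longlongrightarrow> c) at_infinity"
      by (rule tendsto_powi_mult) simp
    then show ?thesis by blast
  qed (auto intro: tendsto_const)
  then obtain n where n: "\<And>r. \<exists>c. ((\<lambda>s. s powi (- int (n r)) * rat_eval r s) \<longlongrightarrow> c) at_infinity"
    by metis
  define N where "N = (\<Sum>i\<in>UNIV. \<Sum>j\<in>UNIV. n (H $ i $ j))"
  have "n (H $ i $ j) \<le> N" for i j
  proof -
    have "n (H $ i $ j) \<le> (\<Sum>j\<in>UNIV. n (H $ i $ j))" by (rule member_le_sum) auto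
    also have "\<dots> \<le> N" unfolding N_def by (rule member_le_sum[of i UNIV "\<lambda>i. \<Sum>j\<in>UNIV. n (H $ i $ j)"]) auto
    finally show ?thesis .
  qed
  \<comment> \<open>The sum of the entrywise exponents serves all entries at once, so some exponent
    is admissible.\<close>
  then have PN: "P (int N)" unfolding P_def using n tendsto_powi_mult by (meson of_nat_mono)
  have "(pole_at_infinity H \<longrightarrow> pole_order_infinity H = 1) \<longleftrightarrow> P 1"
  proof
    assume P1: "P 1"
    show "pole_at_infinity H \<longrightarrow> pole_order_infinity H = 1"
    proof
      assume "pole_at_infinity H"
      then have "\<not> P 0" by (simp add: pole)
      then have "1 \<le> l" if "P l" for l using P_mono[OF that, of 0] by force
      then show "pole_order_infinity H = 1"
        unfolding order using P1 by (intro Least_equality)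
    qed
  next
    assume *: "pole_at_infinity H \<longrightarrow> pole_order_infinity H = 1"
    show "P 1"
    proof (cases "P 0")
      case True
      then show ?thesis by (rule P_mono) simp
    next
      case False
      \<comment> \<open>The integers are not well-ordered, so the minimum is taken over the
        naturals; \<open>\<not> P 0\<close> excludes all exponents up to 0, which makes it the least
        integer as well.\<close>
      define m where "m = (LEAST n. P (int n))"
      have Pm: "P (int m)" unfolding m_def using PN by (rule LeastI)
      have "int m \<le> l" if "P l" for l
      proof -
        have "0 < l" using False P_mono[OF that, of 0] by force
        then have "m \<le> nat l" unfolding m_def using that by (intro Least_le) simp
        then show ?thesis using \<open>0 < l\<close> by simp
      qed
      with Pm have "pole_order_infinity H = int m"
        unfolding order by (intro Least_equality)
      with * False Pm show ?thesis by (simp add: pole)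
    qed
  qed
  then show ?thesis by (simp add: P_def)
qed

text \<open>Growth orders are integers, so growth slower than \<open>s\<close> means a finite limit
  at infinity. That limit bounds \<open>r\<close> outside a large disc; inside, continuity on the
  compact part of the half-plane does.\<close>

lemma rat_bounded_on_half_plane:
  assumes reg: "\<And>s. - \<epsilon> \<le> Re s \<Longrightarrow> rat_regular r s"
    and lim: "((\<lambda>s. s powi (-1) * rat_eval r s) \<longlongrightarrow> 0) at_infinity"
  obtains b where "\<And>s. - \<epsilon> \<le> Re s \<Longrightarrow> norm (rat_eval r s) \<le> b"
proof (cases "r = 0")
  case False
  then obtain k :: int and c where c: "c \<noteq> 0"
    and kc: "((\<lambda>s. s powi (- k) * rat_eval r s) \<longlongrightarrow> c) at_infinity"
    by (rule rat_infinity_asymp)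
  have "k \<le> 0"
  proof (rule ccontr)
    assume "\<not> k \<le> 0"
    then obtain d where "((\<lambda>s::complex. s powi (1 - k)) \<longlongrightarrow> d) at_infinity"
      using tendsto_powi_at_infinity[of "1 - k"] by auto
    from tendsto_mult[OF this lim]
    have "((\<lambda>s. s powi (1 - k) * (s powi (-1) * rat_eval r s)) \<longlongrightarrow> 0) at_infinity" by simp
    then have "((\<lambda>s. s powi (- k) * rat_eval r s) \<longlongrightarrow> 0) at_infinity"
    proof (rule Lim_transform_eventually)
      show "\<forall>\<^sub>F s in at_infinity. s powi (1 - k) * (s powi (-1) * rat_eval r s) = s powi (- k) * rat_eval r s"
        using eventually_nonzero_at_infinity
        by eventually_elim (simp add: power_int_diff power_int_minus field_simps)
    qed
    then show False using kc c tendsto_unique[OF trivial_limit_at_infinity] by blast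
  qed
  then obtain d where "(rat_eval r \<longlongrightarrow> d) at_infinity"
    using tendsto_powi_mult[OF kc, of 0] by auto
  then have "\<forall>\<^sub>F s in at_infinity. dist (rat_eval r s) d < 1" by (rule tendstoD) simp
  then obtain R where R: "\<And>s. R \<le> norm s \<Longrightarrow> dist (rat_eval r s) d < 1"
    by (auto simp: eventually_at_infinity)
  have "continuous_on (cball 0 R \<inter> {s. - \<epsilon> \<le> Re s}) (rat_eval r)"
    using tendsto_rat_eval[OF reg]
    by (intro continuous_at_imp_continuous_on) (auto simp: isCont_def)
  moreover have "compact (cball 0 R \<inter> {s. - \<epsilon> \<le> Re s})"
    by (intro compact_Int_closed closed_halfspace_Re_ge) simp
  ultimately have "bounded (rat_eval r ` (cball 0 R \<inter> {s. - \<epsilon> \<le> Re s}))"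
    by (intro compact_imp_bounded compact_continuous_image)
  then obtain b where "\<forall>x\<in>rat_eval r ` (cball 0 R \<inter> {s. - \<epsilon> \<le> Re s}). norm x \<le> b"
    unfolding bounded_iff by blast
  then have b: "norm (rat_eval r s) \<le> b" if "norm s \<le> R" "- \<epsilon> \<le> Re s" for s
    using that by simp
  show ?thesis
  proof (rule that)
    fix s assume "- \<epsilon> \<le> Re s"
    have "norm (rat_eval r s) \<le> norm d + 1" if "R \<le> norm s"
      using R[OF that] norm_triangle_sub[of "rat_eval r s" d] by (simp add: dist_norm)
    then show "norm (rat_eval r s) \<le> max b (norm d + 1)"
      using b[of s] \<open>- \<epsilon> \<le> Re s\<close> by (cases "R \<le> norm s") auto
  qed
qed (use that[of 0] in simp)

text \<open>There are only finitely many poles, so their largest real part \<open>m\<close> is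
  itself negative, and \<open>- m / 2\<close> leaves room.\<close>

lemma finite_poles_margin:
  assumes "\<And>z. finite_pole H z \<Longrightarrow> Re z < 0"
  obtains \<epsilon> where "\<epsilon> > 0" "\<And>s. - \<epsilon> \<le> Re s \<Longrightarrow> \<not> finite_pole H s"
proof (cases "{z. finite_pole H z} = {}")
  case False
  define m where "m = Max (Re ` {z. finite_pole H z})"
  have m: "m \<in> Re ` {z. finite_pole H z}"
    unfolding m_def using False by (intro Max_in) (auto simp: finite_finite_poles)
  have le: "Re z \<le> m" if "finite_pole H z" for z
    unfolding m_def using that by (intro Max_ge) (auto simp: finite_finite_poles)
  show ?thesis
    using m assms le by (intro that[of "- m / 2"]) force+
qed (use that[of 1] in auto)

section \<open>Polarization\<close>

text \<open>\<open>q c\<close> is the form \<open>x' P x\<close> at \<open>x = e_i + c e_j\<close>,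
  and \<open>q 1 - q (-1) - \<i> q \<i> + \<i> q (-\<i>)\<close> equals \<open>4 P_ij\<close>.
  \<open>Q\<close> is abstract because the identity is used once for regularity at a point and once
  for growth at infinity.\<close>

lemma polarization:
  fixes P :: "ratfun^'m^'m" and i j :: 'm and Q :: "ratfun \<Rightarrow> bool"
  defines "q c \<equiv> P $ i $ i + to_fract [:c:] * P $ i $ j + to_fract [:cnj c:] * P $ j $ i
      + to_fract [:cnj c * c:] * P $ j $ j"
  assumes add: "\<And>r t. Q r \<Longrightarrow> Q t \<Longrightarrow> Q (r + t)"
    and scale: "\<And>c r. Q r \<Longrightarrow> Q (to_fract [:c:] * r)"
    and q: "\<And>c. Q (q c)"
  shows "Q (P $ i $ j)"
proof -
  define I :: ratfun where "I = to_fract [:\<i>:]"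
  have minus1: "to_fract [:-1:] = (-1 :: ratfun)"
    by (metis minus_pCons minus_zero one_pCons to_fract_1 to_fract_uminus)
  have "to_fract [:-\<i>:] = to_fract [:-1:] * I" by (simp add: I_def flip: to_fract_mult)
  then have minusI: "to_fract [:-\<i>:] = - I" by (simp add: minus1)
  have "I * I = to_fract [:-1:]" by (simp add: I_def flip: to_fract_mult)
  then have I2: "I * I = -1" by (simp add: minus1)
  have "to_fract [:4:] = (4 :: ratfun)"
    using of_nat_fract[of 4, where 'a = "complex poly"] by (simp add: of_nat_poly to_fract_def)
  then have quarter: "to_fract [:1/4:] * 4 = (1 :: ratfun)"
    by (simp flip: to_fract_mult one_pCons \<open>to_fract [:4:] = 4\<close>)
  have one: "to_fract [:1:] = (1 :: ratfun)" by (simp flip: one_pCons)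
  have "(q 1 + to_fract [:-1:] * q (-1)) + (to_fract [:-\<i>:] * q \<i> + to_fract [:\<i>:] * q (-\<i>))
    = 4 * P $ i $ j"
  proof -
    have "(q 1 + to_fract [:-1:] * q (-1)) + (to_fract [:-\<i>:] * q \<i> + to_fract [:\<i>:] * q (-\<i>))
      = 2 * P $ i $ j + 2 * P $ j $ i - 2 * (I * I) * P $ i $ j + 2 * (I * I) * P $ j $ i"
      by (simp add: q_def minus1 minusI one I_def[symmetric] algebra_simps)
    then show ?thesis by (simp add: I2)
  qed
  then have "P $ i $ j = to_fract [:1/4:] *
      ((q 1 + to_fract [:-1:] * q (-1)) + (to_fract [:-\<i>:] * q \<i> + to_fract [:\<i>:] * q (-\<i>)))"
    using quarter by (simp flip: mult.assoc)
  also have "Q \<dots>" by (intro add scale q)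
  finally show ?thesis .
qed

text \<open>The margin \<open>\<epsilon>\<close> makes a point of the imaginary axis interior to the
  region of nonnegativity. With \<open>\<epsilon> = 0\<close> the function \<open>1 / s\<close>,
  which has a pole at 0, would be a counterexample.\<close>

lemma positive_real_part_poles:
  fixes P :: "ratfun^'m^'m"
  assumes \<epsilon>: "\<epsilon> > 0"
    and pos: "\<forall>\<^sub>F s in cofinite. - \<epsilon> \<le> Re s \<longrightarrow> (\<forall>x. 0 \<le> inner x (mat_eval P s *v x))"
  shows "0 \<le> Re z \<Longrightarrow> \<not> finite_pole P z"
    and "\<exists>l. ((\<lambda>s. s powi (-1) * rat_eval (P $ i $ j) s) \<longlongrightarrow> l) at_infinity"
proof -
  define q where "q i j c = P $ i $ i + to_fract [:c:] * P $ i $ j + to_fract [:cnj c:] * P $ j $ i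
      + to_fract [:cnj c * c:] * P $ j $ j" for i j c
  have nonneg: "\<forall>\<^sub>F s in cofinite. - \<epsilon> \<le> Re s \<longrightarrow> 0 \<le> Re (rat_eval (q i j c) s)" for i j c
    using pos eventually_not_finite_pole[of P]
  proof eventually_elim
    case (elim s)
    define x where "x = axis i 1 + axis j c"
    have "(M *v axis k a) $ l = M $ l $ k * a" for M :: "complex^'m^'m" and k a l
      by (simp add: matrix_vector_mult_def axis_def if_distrib[where f = "\<lambda>x. _ * x"] cong: if_cong)
    then have "(mat_eval P s *v x) $ l = rat_eval (P $ l $ i) s + rat_eval (P $ l $ j) s * c" for l
      by (simp add: x_def matrix_vector_right_distrib)
    then have "inner x (mat_eval P s *v x) =
        Re (rat_eval (P $ i $ i) s + rat_eval (P $ i $ j) s * c)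
        + Re (cnj c * (rat_eval (P $ j $ i) s + rat_eval (P $ j $ j) s * c))"
      by (simp add: x_def inner_add_left inner_axis' inner_complex_def)
    also have "\<dots> = Re (rat_eval (q i j c) s)"
      using elim(2) by (simp add: q_def finite_pole_iff rat_eval_add rat_eval_mult algebra_simps)
    finally show ?case using elim(1) by metis
  qed
  show "\<not> finite_pole P z" if z: "0 \<le> Re z"
  proof -
    have reg: "rat_regular (q i j c) z" for i j c
    proof (rule rat_regular_if_Re_nonneg)
      have "\<forall>\<^sub>F s in at z. - \<epsilon> < Re s"
        using z \<epsilon> by (intro order_tendstoD(1)[OF tendsto_Re[OF tendsto_ident_at]]) auto
      then show "\<forall>\<^sub>F s in at z. 0 \<le> Re (rat_eval (q i j c) s)"
        using eventually_cofinite_at[OF nonneg] by eventually_elim auto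
    qed
    have "rat_regular (P $ i $ j) z" for i j
    proof (rule polarization[where Q = "\<lambda>r. rat_regular r z" and P = P and i = i and j = j])
      show "rat_regular (r + t) z" if "rat_regular r z" "rat_regular t z" for r t
        using that by (rule rat_eval_add)
      show "rat_regular (to_fract [:c:] * r) z" if "rat_regular r z" for c r
        using rat_eval_const(2) that by (rule rat_eval_mult)
    qed (use reg in \<open>simp only: q_def\<close>)
    then show ?thesis by (simp add: finite_pole_iff)
  qed
  define Q where "Q r \<longleftrightarrow> (\<exists>l. ((\<lambda>s. s powi (-1) * rat_eval r s) \<longlongrightarrow> l) at_infinity)" for r
  have Qq: "Q (q i j c)" for i j c
    unfolding Q_def
  proof (rule rat_order_infinity_le_1_if_Re_nonneg)
    show "\<forall>\<^sub>F s in at_infinity. 0 \<le> Re s \<longrightarrow> 0 \<le> Re (rat_eval (q i j c) s)"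
      using eventually_cofinite_at_infinity[OF nonneg] by eventually_elim (use \<epsilon> in auto)
  qed
  have Qadd: "Q (r + t)" if r: "Q r" and t: "Q t" for r t
  proof -
    from r obtain l where l: "((\<lambda>s. s powi (-1) * rat_eval r s) \<longlongrightarrow> l) at_infinity" unfolding Q_def ..
    from t obtain l' where l': "((\<lambda>s. s powi (-1) * rat_eval t s) \<longlongrightarrow> l') at_infinity" unfolding Q_def ..
    have "((\<lambda>s. s powi (-1) * rat_eval (r + t) s) \<longlongrightarrow> l + l') at_infinity"
      using tendsto_add[OF l l']
    proof (rule Lim_transform_eventually)
      show "\<forall>\<^sub>F s in at_infinity. s powi (-1) * rat_eval r s + s powi (-1) * rat_eval t s = s powi (-1) * rat_eval (r + t) s"
        using eventually_cofinite_at_infinity[OF eventually_rat_regular[of r]]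
          eventually_cofinite_at_infinity[OF eventually_rat_regular[of t]]
        by eventually_elim (simp add: rat_eval_add distrib_left)
    qed
    then show ?thesis unfolding Q_def ..
  qed
  have Qscale: "Q (to_fract [:c:] * r)" if r: "Q r" for c r
  proof -
    from r obtain l where l: "((\<lambda>s. s powi (-1) * rat_eval r s) \<longlongrightarrow> l) at_infinity" unfolding Q_def ..
    have "((\<lambda>s. s powi (-1) * rat_eval (to_fract [:c:] * r) s) \<longlongrightarrow> c * l) at_infinity"
      using tendsto_mult_left[OF l]
    proof (rule Lim_transform_eventually)
      show "\<forall>\<^sub>F s in at_infinity. c * (s powi (-1) * rat_eval r s) = s powi (-1) * rat_eval (to_fract [:c:] * r) s"
        using eventually_cofinite_at_infinity[OF eventually_rat_regular[of r]]
        by eventually_elim (simp add: rat_eval_mult)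
    qed
    then show ?thesis unfolding Q_def ..
  qed
  have "Q (P $ i $ j)"
    by (rule polarization[where Q = Q and P = P and i = i and j = j, OF Qadd Qscale])
      (use Qq in \<open>simp_all only: q_def\<close>)
  then show "\<exists>l. ((\<lambda>s. s powi (-1) * rat_eval (P $ i $ j) s) \<longlongrightarrow> l) at_infinity"
    by (simp add: Q_def)
qed

section \<open>Matrices over the real or complex numbers\<close>

context
  fixes F :: "complex set"
  assumes F: "F = \<real> \<or> F = UNIV"
begin

lemma entries_in_mult: "entries_in F M \<Longrightarrow> entries_in F N \<Longrightarrow> entries_in F (M ** N)"
  using F by (auto simp: entries_in_def matrix_matrix_mult_def intro!: sum_in_Reals Reals_mult)

lemma entries_in_add: "entries_in F M \<Longrightarrow> entries_in F N \<Longrightarrow> entries_in F (M + N)"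
  using F by (auto simp: entries_in_def)

lemma entries_in_diff: "entries_in F M \<Longrightarrow> entries_in F N \<Longrightarrow> entries_in F (M - N)"
  using F by (auto simp: entries_in_def)

lemma entries_in_mat_of_real: "entries_in F (mat (of_real c))"
  using F by (auto simp: entries_in_def mat_def)

lemma entries_in_conj_transpose: "entries_in F M \<Longrightarrow> entries_in F (conj_transpose M)"
  using F by (auto simp: entries_in_def conj_transpose_def Reals_cnj_iff)

text \<open>In the real case the entrywise conjugate of the inverse is an inverse of
  \<open>M\<close> too, and inverses are unique.\<close>

lemma entries_in_matrix_inv:
  fixes M :: "complex^'m^'m"
  assumes M: "entries_in F M" and inv: "invertible M"
  shows "entries_in F (matrix_inv M)"
proof (cases "F = UNIV")
  case False
  then have FR: "F = \<real>" using F by simp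
  define X where "X = matrix_inv M"
  have "M ** (\<chi> i j. cnj (X $ i $ j)) = mat 1"
  proof -
    have "(M ** (\<chi> i j. cnj (X $ i $ j))) $ i $ j = cnj ((M ** X) $ i $ j)" for i j
      using M by (simp add: matrix_matrix_mult_def FR entries_in_def Reals_cnj_iff)
    then show ?thesis by (simp add: X_def matrix_inv_invertible inv vec_eq_iff mat_def)
  qed
  then have "X = (\<chi> i j. cnj (X $ i $ j))" unfolding X_def by (rule matrix_inv_eqI(2))
  then have "cnj (X $ i $ j) = X $ i $ j" for i j by (metis vec_lambda_beta)
  then show ?thesis by (simp add: X_def entries_in_def FR Reals_cnj_iff)
qed (simp add: entries_in_def)

text \<open>Inner inverses are not unique, so the complex construction need not return a real one
  for a real \<open>M\<close>. In the real case it is carried out over the reals and then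
  embedded.\<close>

lemma ex_inner_inverse_entries_in:
  fixes M :: "complex^'m^'m"
  assumes "entries_in F M"
  obtains U where "entries_in F U" "invertible U" "M ** U ** M = M"
proof (cases "F = UNIV")
  case True
  then show ?thesis using ex_invertible_inner_inverse[of M] that by (auto simp: entries_in_def)
next
  case False
  then have FR: "F = \<real>" using F by simp
  define c where "c = (map_matrix of_real :: real^'m^'m \<Rightarrow> complex^'m^'m)"
  have c_mult: "c (X ** Y) = c X ** c Y" for X Y
    by (simp add: c_def vec_eq_iff matrix_matrix_mult_def)
  have c_1: "c (mat 1) = mat 1" by (simp add: c_def vec_eq_iff mat_def)
  define M\<^sub>0 where "M\<^sub>0 = (\<chi> i j. Re (M $ i $ j))"
  have M: "M = c M\<^sub>0"
    using assms by (simp add: c_def M\<^sub>0_def vec_eq_iff FR entries_in_def)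
  obtain U\<^sub>0 where U\<^sub>0: "invertible U\<^sub>0" "M\<^sub>0 ** U\<^sub>0 ** M\<^sub>0 = M\<^sub>0"
    using ex_invertible_inner_inverse[of M\<^sub>0] by blast
  show ?thesis
  proof (rule that)
    show "entries_in F (c U\<^sub>0)" by (simp add: c_def entries_in_def FR)
    show "invertible (c U\<^sub>0)"
      using U\<^sub>0(1) unfolding invertible_right_inverse by (metis c_mult c_1)
    show "M ** c U\<^sub>0 ** M = M" unfolding M by (simp add: U\<^sub>0(2) flip: c_mult)
  qed
qed

text \<open>With \<open>U\<close> an invertible inner inverse of \<open>M\<close>, the matrix \<open>Q = M U\<close> is idempotent, and an
  invertible \<open>W\<close> with \<open>Q W = Q Q'\<close> turns \<open>N = U W\<close> into the required multiplier.\<close>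

lemma ex_psd_multiplier:
  fixes M :: "complex^'m^'m"
  assumes M: "entries_in F M"
  obtains N Q :: "complex^'m^'m" where "entries_in F N" "invertible N" "M ** N = Q ** conj_transpose Q"
proof -
  obtain U where U: "entries_in F U" "invertible U" "M ** U ** M = M"
    using M by (rule ex_inner_inverse_entries_in)
  define Q where "Q = M ** U"
  define Q1 where "Q1 = mat 1 - Q"
  define W where "W = conj_transpose Q + Q1 ** conj_transpose Q1"
  have QQ: "Q ** Q = Q" by (simp add: Q_def matrix_mul_assoc U(3))
  have "Q ** Q1 = 0"
    by (simp add: Q1_def QQ matrix_eq matrix_vector_mult_diff_rdistrib matrix_vector_mult_diff_distrib
        flip: matrix_vector_mul_assoc) (simp add: QQ matrix_vector_mul_assoc)
  then have "Q ** (Q1 ** conj_transpose Q1) = 0" by (simp add: matrix_mul_assoc)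
  then have QW: "Q ** W = Q ** conj_transpose Q" by (simp add: W_def matrix_add_ldistrib)
  have entries_mat1: "entries_in F (mat 1)" using entries_in_mat_of_real[of 1] by simp
  have "invertible W"
    unfolding invertible_iff_ker
  proof (intro allI impI)
    fix x assume x: "W *v x = 0"
    \<comment> \<open>From \<open>Q Q' x = 0\<close> follows \<open>Q' x = 0\<close>, which reduces
      \<open>W x = 0\<close> to \<open>Q1 x = 0\<close>, that is, \<open>Q x = x\<close>. Then
      \<open>inner x x = inner (Q' x) x = 0\<close>.\<close>
    have "Q *v (conj_transpose Q *v x) = (Q ** W) *v x" by (simp add: QW matrix_vector_mul_assoc)
    also have "\<dots> = 0" using x by (simp flip: matrix_vector_mul_assoc)
    finally have "inner (conj_transpose Q *v x) (conj_transpose Q *v x) = 0"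
      by (simp add: inner_conj_transpose)
    then have Qx: "conj_transpose Q *v x = 0" by simp
    have "conj_transpose Q1 = mat 1 - conj_transpose Q"
      by (simp add: Q1_def conj_transpose_def vec_eq_iff mat_def)
    then have "conj_transpose Q1 *v x = x" using Qx by (simp add: matrix_vector_mult_diff_rdistrib)
    then have "Q1 *v x = 0"
      using x Qx by (simp add: W_def matrix_vector_mult_add_rdistrib flip: matrix_vector_mul_assoc)
    then have "Q *v x = x" by (simp add: Q1_def matrix_vector_mult_diff_rdistrib)
    then have "inner x x = inner x (Q *v x)" by simp
    also have "\<dots> = 0" by (simp add: Qx flip: inner_conj_transpose)
    finally show "x = 0" by simp
  qed
  show ?thesis
  proof (rule that[of "U ** W" Q])
    show "entries_in F (U ** W)"
      unfolding W_def Q1_def Q_def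
      by (intro entries_in_mult entries_in_add entries_in_diff entries_in_conj_transpose M U entries_mat1)
    show "invertible (U ** W)" by (intro invertible_mult U \<open>invertible W\<close>)
    show "M ** (U ** W) = Q ** conj_transpose Q"
      using QW by (simp add: Q_def matrix_mul_assoc)
  qed
qed

end

section \<open>Norm bounds, and invertibility along a line of matrices\<close>

lemma ex_matrix_vector_bound:
  fixes M :: "complex^'n^'m"
  obtains c where "c > 0" "\<And>x. norm (M *v x) \<le> c * norm x"
proof -
  obtain k where k: "k > 0" "\<And>(M::complex^'n^'m) x. norm (M *v x) \<le> norm M * norm x * k"
    using bounded_bilinear.pos_bounded[OF bounded_bilinear_matrix_vector_mult] by blast
  show ?thesis
  proof (rule that[of "norm M * k + 1"])
    show "norm (M *v x) \<le> (norm M * k + 1) * norm x" for x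
      using k(2)[of M x] by (simp add: algebra_simps add_increasing)
  qed (use k in \<open>simp add: add_nonneg_pos\<close>)
qed

lemma norm_matrix_le_sum: "norm M \<le> (\<Sum>i\<in>UNIV. \<Sum>j\<in>UNIV. norm (M $ i $ j))"
  for M :: "complex^'n^'m"
proof -
  have "norm M \<le> (\<Sum>i\<in>UNIV. norm (M $ i))"
    unfolding norm_vec_def[of M] by (rule L2_set_le_sum) simp
  also have "\<dots> \<le> (\<Sum>i\<in>UNIV. \<Sum>j\<in>UNIV. norm (M $ i $ j))"
    by (intro sum_mono) (simp add: norm_vec_def L2_set_le_sum)
  finally show ?thesis .
qed

lemma mat_mult_vec: "mat c *v x = c *s x"
  by (simp add: vec_eq_iff matrix_vector_mult_def mat_def if_distrib[where f = "\<lambda>x. x * _"] cong: if_cong)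

lemma norm_smult_vec: "norm (c *s x) = norm c * norm x" for x :: "complex^'m"
  by (simp add: norm_vec_def L2_set_def norm_mult power_mult_distrib sum_distrib_left[symmetric] real_sqrt_mult)

text \<open>The determinant is a polynomial in \<open>t\<close> with value 1 at 0, so it has
  finitely many roots. This lets the gain \<open>k\<close> grow while \<open>I - K D\<close> stays
  non-singular.\<close>

lemma eventually_invertible_affine:
  fixes M :: "complex^'m^'m"
  shows "\<forall>\<^sub>F t in at_top. invertible (mat 1 + mat (of_real t) ** M)"
proof -
  define p where "p = det (\<chi> i j. [:mat 1 $ i $ j, M $ i $ j:])"
  have p: "poly p t = det (mat 1 + mat t ** M)" for t
  proof -
    have "(mat 1 + mat t ** M) $ i $ j = mat 1 $ i $ j + t * M $ i $ j" for i j
      by (simp add: matrix_matrix_mult_def mat_def if_distrib[where f = "\<lambda>x. x * _"] cong: if_cong)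
    then show ?thesis by (simp add: p_def det_def poly_sum poly_prod)
  qed
  have "mat 0 ** M = 0" by (simp add: vec_eq_iff matrix_matrix_mult_def mat_def)
  then have "poly p 0 \<noteq> 0" by (simp add: p)
  then have "p \<noteq> 0" by auto
  then have "\<forall>\<^sub>F t in cofinite. poly p t \<noteq> 0" by (simp add: eventually_cofinite poly_roots_finite)
  then have "\<forall>\<^sub>F t in at_top. poly p (of_real t) \<noteq> 0"
    by (rule eventually_compose_filterlim[OF eventually_cofinite_at_infinity filterlim_of_real_at_infinity])
  then show ?thesis by (simp add: p invertible_det_nz)
qed

section \<open>The closed loop\<close>

lemma eventually_transfer_function:
  assumes regular: "det (pencil rat_s (const_rat E) (const_rat A)) \<noteq> 0"
    and G: "G = transfer_function E A B C D"
  shows "\<forall>\<^sub>F s in cofinite. invertible (pencil s E A) \<and>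
    mat_eval G s = C ** matrix_inv (pencil s E A) ** B + D"
proof -
  have inv: "invertible (pencil rat_s (const_rat E) (const_rat A))"
    using regular by (simp add: invertible_det_nz)
  show ?thesis
    using mat_eval_matrix_inv[OF inv]
      eventually_not_finite_pole[of "matrix_inv (pencil rat_s (const_rat E) (const_rat A))"]
  proof eventually_elim
    case (elim s)
    then show ?case
      by (simp add: G transfer_function_def mat_eval_add mat_eval_mult)
  qed
qed

text \<open>If \<open>X\<close> and \<open>Y\<close> solve the Bezout identity at \<open>z\<close>,
  then \<open>(s E - A) X + B Y\<close> is \<open>S = I + (s - z) E X\<close>, which is invertible
  for \<open>s\<close> near \<open>z\<close>; so \<open>a = X S^-1 e\<close> and
  \<open>b = Y S^-1 e\<close>. The point is that \<open>\<alpha>\<close> does not depend on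
  \<open>s\<close>: these corrections will be multiplied by \<open>s - z\<close>.\<close>

lemma eventually_controllable_bounded:
  fixes E A :: "complex^'n^'n" and B :: "complex^'m^'n"
  assumes "\<not> uncontrollable_eigenvalue E A B z"
  obtains \<alpha> where "\<forall>\<^sub>F s in at z. \<exists>a b. norm a \<le> \<alpha> \<and> norm b \<le> \<alpha> \<and> pencil s E A *v a + B *v b = e"
proof -
  obtain X Y where XY: "pencil z E A ** X + B ** Y = mat 1"
    using assms by (auto simp: controllable_iff)
  obtain c where c: "c > 0" "\<And>x. norm ((E ** X) *v x) \<le> c * norm x"
    using ex_matrix_vector_bound[of "E ** X"] by metis
  obtain c1 where c1: "c1 > 0" "\<And>x. norm (X *v x) \<le> c1 * norm x"
    using ex_matrix_vector_bound[of X] by metis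
  obtain c2 where c2: "c2 > 0" "\<And>x. norm (Y *v x) \<le> c2 * norm x"
    using ex_matrix_vector_bound[of Y] by metis
  define \<alpha> where "\<alpha> = (c1 + c2) * (2 * norm e)"
  have "\<exists>a b. norm a \<le> \<alpha> \<and> norm b \<le> \<alpha> \<and> pencil s E A *v a + B *v b = e"
    if s: "norm (s - z) * c \<le> 1 / 2" for s
  proof -
    define S where "S = mat 1 + mat (s - z) ** (E ** X)"
    have S: "S *v x = x + (s - z) *s ((E ** X) *v x)" for x
      by (simp add: S_def matrix_vector_mult_add_rdistrib mat_mult_vec flip: matrix_vector_mul_assoc)
    have small: "norm ((s - z) *s ((E ** X) *v x)) \<le> norm x / 2" for x
    proof -
      have "norm ((s - z) *s ((E ** X) *v x)) \<le> norm (s - z) * (c * norm x)"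
        unfolding norm_smult_vec by (intro mult_left_mono c(2)) simp
      also have "\<dots> \<le> 1 / 2 * norm x"
        using mult_right_mono[OF s, of "norm x"] by (simp add: mult.assoc)
      finally show ?thesis by simp
    qed
    \<comment> \<open>One estimate serves twice: it makes \<open>S\<close> injective and it bounds
      \<open>w\<close>, whence the factor 2 in \<open>\<alpha>\<close>.\<close>
    have bound: "norm x \<le> 2 * norm (S *v x)" for x
      using small[of x] norm_triangle_ineq4[of "S *v x" "(s - z) *s ((E ** X) *v x)"] by (simp add: S)
    then have "invertible S" unfolding invertible_iff_ker by (metis mult_zero_right norm_le_zero_iff norm_zero)
    define w where "w = matrix_inv S *v e"
    have Sw: "S *v w = e"
      by (simp add: w_def matrix_vector_mul_assoc matrix_inv_invertible \<open>invertible S\<close>)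
    have wn: "norm w \<le> 2 * norm e" using bound[of w] by (simp add: Sw)
    have "norm (X *v w) \<le> c1 * (2 * norm e)" "norm (Y *v w) \<le> c2 * (2 * norm e)"
      using c1 c2 wn by (meson mult_left_mono order_trans less_imp_le)+
    then have "norm (X *v w) \<le> \<alpha>" "norm (Y *v w) \<le> \<alpha>"
      using c1(1) c2(1) by (simp_all add: \<alpha>_def distrib_right add_increasing add_increasing2)
    moreover have "pencil s E A *v (X *v w) + B *v (Y *v w) = e"
    proof -
      have add_swap: "p + q = r \<Longrightarrow> (p + t) + q = r + t" for p q r t :: "complex^'n"
        by (auto simp: ac_simps)
      have "pencil s E A *v (X *v w) = pencil z E A *v (X *v w) + (s - z) *s (E *v (X *v w))"
        by (simp add: pencil_mult_vec vec_eq_iff algebra_simps)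
      moreover have "pencil z E A *v (X *v w) + B *v (Y *v w) = w"
        using XY by (simp add: matrix_vector_mul_assoc flip: matrix_vector_mult_add_rdistrib)
      ultimately have "pencil s E A *v (X *v w) + B *v (Y *v w) = w + (s - z) *s (E *v (X *v w))"
        using add_swap by simp
      also have "\<dots> = e" using Sw unfolding S matrix_vector_mul_assoc .
      finally show ?thesis .
    qed
    ultimately show ?thesis by blast
  qed
  moreover have "\<forall>\<^sub>F s in at z. norm (s - z) * c \<le> 1 / 2"
  proof -
    have "((\<lambda>s. norm (s - z) * c) \<longlongrightarrow> norm (z - z) * c) (at z)" by (intro tendsto_intros)
    then have "\<forall>\<^sub>F s in at z. norm (s - z) * c < 1 / 2" by (rule order_tendstoD) simp
    then show ?thesis by eventually_elim simp
  qed
  ultimately show ?thesis by (intro that[of \<alpha>]) (simp add: eventually_mono)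
qed

lemma pencil_add_right: "pencil z E (A + N) = pencil z E A - N"
  by (simp add: pencil_def vec_eq_iff)

text \<open>A closed-loop eigenvector \<open>v\<close> at \<open>z\<close> has an output \<open>y\<close> and input \<open>u = K y\<close>. Controllability
  extends it to trajectories of the open loop at nearby \<open>s\<close>, whose limit gives \<open>(G\<^sup>-\<^sup>1(z) - K) y = 0\<close>.
  So \<open>y = 0\<close>, and \<open>v\<close> is unobservable.\<close>

lemma not_closed_loop_eigenvalue:
  fixes E A :: "complex^'n^'n" and B :: "complex^'m^'n"
    and C :: "complex^'n^'m" and D K :: "complex^'m^'m" and G :: "ratfun^'m^'m"
  assumes regular: "det (pencil rat_s (const_rat E) (const_rat A)) \<noteq> 0"
    and G: "G = transfer_function E A B C D"
    and invG: "invertible G"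
    and invKD: "invertible (mat 1 - K ** D)"
    and con: "\<not> uncontrollable_eigenvalue E A B z"
    and obs: "\<not> unobservable_eigenvalue E A C z"
    and pole: "\<not> finite_pole (matrix_inv G) z"
    and inj: "invertible (mat_eval (matrix_inv G) z - K)"
  shows "\<not> pair_eigenvalue E (A + B ** matrix_inv (mat 1 - K ** D) ** K ** C) z"
proof
  assume "pair_eigenvalue E (A + B ** matrix_inv (mat 1 - K ** D) ** K ** C) z"
  then obtain v where v: "v \<noteq> 0" "pencil z E (A + B ** matrix_inv (mat 1 - K ** D) ** K ** C) *v v = 0"
    by (auto simp: pair_eigenvalue_def)
  define u where "u = matrix_inv (mat 1 - K ** D) *v (K *v (C *v v))"
  define y where "y = C *v v + D *v u"
  have zv: "pencil z E A *v v = B *v u"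
    using v(2) by (simp add: pencil_add_right matrix_vector_mult_diff_rdistrib u_def matrix_vector_mul_assoc matrix_mul_assoc)
  have "(mat 1 - K ** D) *v u = K *v (C *v v)"
    by (simp add: u_def matrix_vector_mul_assoc matrix_mul_assoc matrix_inv_invertible invKD)
  then have uy: "u = K *v y"
    by (simp add: y_def matrix_vector_mult_diff_rdistrib matrix_vector_right_distrib
        matrix_vector_mul_assoc algebra_simps)
  \<comment> \<open>\<open>G\<close> may have a pole at \<open>z\<close>, so the loop equations
    cannot be evaluated there. Passing to \<open>s\<close> changes \<open>(z E - A) v\<close> by
    \<open>(s - z) E v\<close>, and controllability distributes this excess between state and input
    at bounded cost.\<close>
  obtain \<alpha> where \<alpha>: "\<forall>\<^sub>F s in at z. \<exists>a b. norm a \<le> \<alpha> \<and> norm b \<le> \<alpha> \<and>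
      pencil s E A *v a + B *v b = E *v v"
    using con by (rule eventually_controllable_bounded)
  obtain cC where cC: "cC > 0" "\<And>x. norm (C *v x) \<le> cC * norm x"
    using ex_matrix_vector_bound[of C] by metis
  obtain cD where cD: "cD > 0" "\<And>x. norm (D *v x) \<le> cD * norm x"
    using ex_matrix_vector_bound[of D] by metis
  obtain k where k: "k > 0" "\<And>(M::complex^'m^'m) x. norm (M *v x) \<le> norm M * norm x * k"
    using bounded_bilinear.pos_bounded[OF bounded_bilinear_matrix_vector_mult] by blast
  \<comment> \<open>Tends to 0 at \<open>z\<close>: the second factor converges there because
    \<open>G^-1\<close> is regular at \<open>z\<close>.\<close>
  define \<beta> where "\<beta> s = norm (s - z) * (\<alpha> + norm (mat_eval (matrix_inv G) s) * ((cD + cC) * \<alpha>) * k)" for s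
  have "\<forall>\<^sub>F s in at z. norm ((mat_eval (matrix_inv G) s - K) *v y) \<le> \<beta> s"
    using \<alpha> eventually_cofinite_at[OF eventually_transfer_function[OF regular G]]
      eventually_cofinite_at[OF mat_eval_matrix_inv[OF invG]]
  proof eventually_elim
    case (elim s)
    obtain a b where ab: "norm a \<le> \<alpha>" "norm b \<le> \<alpha>" "pencil s E A *v a + B *v b = E *v v"
      using elim(1) by blast
    define x where "x = v - (s - z) *s a"
    define u' where "u' = u + (s - z) *s b"
    define h where "h = D *v b - C *v a"
    have "pencil s E A *v v = pencil z E A *v v + (s - z) *s (E *v v)"
      by (simp add: pencil_mult_vec vec_eq_iff algebra_simps)
    then have "pencil s E A *v x = B *v u'"
      unfolding x_def u'_def zv ab(3)[symmetric]
      by (simp add: matrix_vector_mult_diff_distrib matrix_vector_right_distrib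
          vec.scale vec_eq_iff algebra_simps)
    then have "x = matrix_inv (pencil s E A) *v (B *v u')"
      using elim(2) by (metis matrix_inv_invertible(2) matrix_vector_mul_assoc matrix_vector_mul_lid)
    then have "mat_eval G s *v u' = C *v x + D *v u'"
      using elim(2) by (simp add: matrix_vector_mult_add_rdistrib matrix_vector_mul_assoc matrix_mul_assoc)
    also have "\<dots> = y + (s - z) *s h"
      by (simp add: x_def u'_def y_def h_def matrix_vector_mult_diff_distrib
          matrix_vector_right_distrib vec.scale vec_eq_iff algebra_simps)
    finally have "mat_eval (matrix_inv G) s *v (y + (s - z) *s h) = u'"
      using elim(3) by (metis matrix_inv_invertible(2) matrix_vector_mul_assoc matrix_vector_mul_lid)
    then have eq: "(mat_eval (matrix_inv G) s - K) *v y = (s - z) *s (b - mat_eval (matrix_inv G) s *v h)"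
      unfolding u'_def
      by (simp add: uy matrix_vector_mult_diff_rdistrib matrix_vector_right_distrib vec.scale
          vec_eq_iff algebra_simps)
    have "norm h \<le> (cD + cC) * \<alpha>"
    proof -
      have "norm (C *v a) \<le> cC * \<alpha>" "norm (D *v b) \<le> cD * \<alpha>"
        using cC cD ab(1,2) by (meson mult_left_mono order_trans less_imp_le)+
      then show ?thesis
        using norm_triangle_ineq4[of "D *v b" "C *v a"] by (simp add: h_def distrib_right)
    qed
    then have "norm (mat_eval (matrix_inv G) s *v h) \<le> norm (mat_eval (matrix_inv G) s) * ((cD + cC) * \<alpha>) * k"
      using k by (intro order_trans[OF k(2)] mult_right_mono mult_left_mono) auto
    then show ?case
      unfolding eq \<beta>_def norm_smult_vec using ab(2)
      by (intro mult_left_mono order_trans[OF norm_triangle_ineq4] add_mono) auto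
  qed
  moreover have "(\<beta> \<longlongrightarrow> norm (z - z) * (\<alpha> + norm (mat_eval (matrix_inv G) z) * ((cD + cC) * \<alpha>) * k)) (at z)"
    unfolding \<beta>_def by (intro tendsto_intros tendsto_mat_eval pole)
  moreover have "((\<lambda>s. norm ((mat_eval (matrix_inv G) s - K) *v y)) \<longlongrightarrow>
      norm ((mat_eval (matrix_inv G) z - K) *v y)) (at z)"
    by (intro tendsto_intros tendsto_matrix_vector_mult tendsto_mat_eval pole)
  ultimately have "norm ((mat_eval (matrix_inv G) z - K) *v y)
      \<le> norm (z - z) * (\<alpha> + norm (mat_eval (matrix_inv G) z) * ((cD + cC) * \<alpha>) * k)"
    by (intro tendsto_le[of "at z" \<beta>]) auto
  then have "(mat_eval (matrix_inv G) z - K) *v y = 0" by simp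
  then have "y = 0" using inj by (simp add: invertible_iff_ker)
  moreover from this have "u = 0" by (simp add: uy)
  ultimately have "C *v v = 0" by (simp add: y_def)
  then show False using zv v(1) obs \<open>u = 0\<close> by (auto simp: observable_iff)
qed

section \<open>The two implications\<close>

text \<open>As \<open>\<epsilon> > 0\<close>, the half-plane contains a neighbourhood of 0, hence
  infinitely many points.\<close>

lemma invertible_ratmat_half_planeI:
  fixes H :: "ratfun^'m^'m"
  assumes \<epsilon>: "\<epsilon> > 0" and inv: "\<forall>\<^sub>F s in cofinite. - \<epsilon> \<le> Re s \<longrightarrow> invertible (mat_eval H s)"
  shows "invertible H"
proof (rule invertible_ratmatI, unfold frequently_def, rule notI)
  assume "\<forall>\<^sub>F s in cofinite. \<not> invertible (mat_eval H s)"
  with inv have "\<forall>\<^sub>F s in cofinite. Re s < - \<epsilon>" by eventually_elim auto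
  then have "\<forall>\<^sub>F s in at 0. Re s < - \<epsilon>" by (rule eventually_cofinite_at)
  moreover have "\<forall>\<^sub>F s in at 0. - \<epsilon> < Re s"
    using \<epsilon> by (intro order_tendstoD(1)[OF tendsto_Re[OF tendsto_ident_at]]) auto
  ultimately have "\<forall>\<^sub>F s::complex in at 0. False" by eventually_elim auto
  then show False by simp
qed

lemma invertible_factors:
  fixes X Y :: "'a::field^'n^'n"
  assumes "invertible (X ** Y)"
  shows "invertible X" and "invertible Y"
  using assms by (simp_all add: invertible_det_nz det_mul)

text \<open>Invertibility of \<open>G\<close> comes from that of \<open>T\<close>, whose values are
  injective wherever their form is positive. Then \<open>P T = I\<close> exhibits
  \<open>P L J^-1\<close> as the inverse of \<open>G\<close>, and multiplication by
  \<open>J = I - G K\<close> gives \<open>G^-1 = P L + K\<close>. Since \<open>K\<close> and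
  \<open>L\<close> are constant, \<open>G^-1\<close> inherits regularity and growth from
  \<open>P\<close>.\<close>

lemma spr_closed_loop_imp_inverse:
  fixes K L :: "complex^'m^'m" and G :: "ratfun^'m^'m"
  assumes invJ: "invertible (mat 1 - G ** const_rat K)"
    and spr: "strictly_positive_real (const_rat L ** matrix_inv (mat 1 - G ** const_rat K) ** G)"
  shows "invertible G"
    and "0 \<le> Re z \<Longrightarrow> \<not> finite_pole (matrix_inv G) z"
    and "\<exists>l. ((\<lambda>s. s powi (-1) * rat_eval (matrix_inv G $ i $ j) s) \<longlongrightarrow> l) at_infinity"
proof -
  define J where "J = mat 1 - G ** const_rat K"
  define T where "T = const_rat L ** matrix_inv J ** G"
  obtain \<epsilon> where \<epsilon>: "\<epsilon> > 0"
    and pos: "\<And>s x. - \<epsilon> \<le> Re s \<Longrightarrow> \<not> finite_pole T s \<Longrightarrow> x \<noteq> 0 \<Longrightarrow> inner x (mat_eval T s *v x) > 0"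
    using spr by (auto simp: strictly_positive_real_def pos_definite_hermitian_part_iff T_def J_def)
  have invTs: "invertible (mat_eval T s)" if "- \<epsilon> \<le> Re s" "\<not> finite_pole T s" for s
    unfolding invertible_iff_ker using pos[OF that] by (metis inner_zero_right less_irrefl)
  have invT: "invertible T"
    using eventually_not_finite_pole[of T]
    by (intro invertible_ratmat_half_planeI[OF \<epsilon>]) (auto elim!: eventually_mono intro: invTs)
  then show invG: "invertible G" unfolding T_def by (rule invertible_factors)
  define P where "P = matrix_inv T"
  have P_pos: "\<forall>\<^sub>F s in cofinite. - \<epsilon> \<le> Re s \<longrightarrow> (\<forall>x. 0 \<le> inner x (mat_eval P s *v x))"
    using eventually_not_finite_pole[of T] mat_eval_matrix_inv[OF invT]
  proof eventually_elim
    case (elim s)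
    show ?case
    proof (intro impI allI)
      fix x assume s: "- \<epsilon> \<le> Re s"
      define y where "y = mat_eval P s *v x"
      have "mat_eval T s *v y = x"
        using elim(2) by (simp add: y_def P_def matrix_vector_mul_assoc matrix_inv_invertible)
      then have "inner x (mat_eval P s *v x) = inner y (mat_eval T s *v y)"
        by (simp add: y_def inner_commute)
      also have "\<dots> \<ge> 0" using pos[OF s elim(1), of y] by (cases "y = 0") auto
      finally show "0 \<le> inner x (mat_eval P s *v x)" .
    qed
  qed
  have "P ** T = mat 1" by (simp add: P_def matrix_inv_invertible invT)
  then have "(P ** const_rat L ** matrix_inv J) ** G = mat 1" by (simp add: T_def matrix_mul_assoc)
  then have "P ** const_rat L ** matrix_inv J = matrix_inv G"
    by (metis matrix_inv_eqI(2) matrix_left_right_inverse)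
  then have "P ** const_rat L ** (matrix_inv J ** J) = matrix_inv G ** J" by (simp add: matrix_mul_assoc)
  also have "matrix_inv J ** J = mat 1" using invJ by (simp add: J_def matrix_inv_invertible)
  also have "matrix_inv G ** J = matrix_inv G - const_rat K"
  proof -
    have "matrix_inv G ** J + const_rat K = matrix_inv G ** (J + G ** const_rat K)"
      by (simp add: matrix_add_ldistrib matrix_mul_assoc matrix_inv_invertible invG)
    then have "matrix_inv G ** J + const_rat K = matrix_inv G" by (simp add: J_def)
    then show ?thesis by (simp add: eq_diff_eq)
  qed
  finally have Ginv: "matrix_inv G = P ** const_rat L + const_rat K" by (simp add: eq_diff_eq)
  show "\<not> finite_pole (matrix_inv G) z" if "0 \<le> Re z"
    unfolding Ginv using positive_real_part_poles(1)[OF \<epsilon> P_pos that]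
    by (intro mat_eval_add mat_eval_mult) auto
  obtain l where l: "\<And>i j. ((\<lambda>s. s powi (-1) * rat_eval (P $ i $ j) s) \<longlongrightarrow> l i j) at_infinity"
    using positive_real_part_poles(2)[OF \<epsilon> P_pos] by metis
  have inv0: "((\<lambda>s::complex. s powi (-1)) \<longlongrightarrow> 0) at_infinity"
    using tendsto_inverse_0 by (simp add: power_int_minus)
  have "((\<lambda>s. (\<Sum>k\<in>UNIV. (s powi (-1) * rat_eval (P $ i $ k) s) * L $ k $ j) + s powi (-1) * K $ i $ j)
      \<longlongrightarrow> (\<Sum>k\<in>UNIV. l i k * L $ k $ j) + 0 * K $ i $ j) at_infinity"
    by (intro tendsto_intros l inv0)
  then have "((\<lambda>s. s powi (-1) * rat_eval (matrix_inv G $ i $ j) s)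
      \<longlongrightarrow> (\<Sum>k\<in>UNIV. l i k * L $ k $ j) + 0 * K $ i $ j) at_infinity"
  proof (rule Lim_transform_eventually)
    show "\<forall>\<^sub>F s in at_infinity.
      (\<Sum>k\<in>UNIV. (s powi (-1) * rat_eval (P $ i $ k) s) * L $ k $ j) + s powi (-1) * K $ i $ j =
      s powi (-1) * rat_eval (matrix_inv G $ i $ j) s"
      using eventually_cofinite_at_infinity[OF eventually_not_finite_pole[of P]]
    proof eventually_elim
      case (elim s)
      have "mat_eval (matrix_inv G) s = mat_eval P s ** L + K"
        unfolding Ginv using elim by (simp add: mat_eval_add mat_eval_mult)
      then have "mat_eval (matrix_inv G) s $ i $ j = (mat_eval P s ** L + K) $ i $ j" by simp
      then have "rat_eval (matrix_inv G $ i $ j) s = (\<Sum>k\<in>UNIV. rat_eval (P $ i $ k) s * L $ k $ j) + K $ i $ j"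
        by (simp add: matrix_matrix_mult_def)
      then show ?case by (simp add: distrib_left sum_distrib_left mult.assoc)
    qed
  qed
  then show "\<exists>l. ((\<lambda>s. s powi (-1) * rat_eval (matrix_inv G $ i $ j) s) \<longlongrightarrow> l) at_infinity" ..
qed

text \<open>By contraposition through right inverses: a right inverse \<open>X\<close> of the
  closed-loop pencil makes \<open>X\<close> and \<open>- N X\<close> a solution of the open-loop
  Bezout identity.\<close>

lemma uncontrollable_imp_feedback_eigenvalue:
  fixes E A :: "complex^'n^'n" and B :: "complex^'m^'n"
  assumes "uncontrollable_eigenvalue E A B z"
  shows "pair_eigenvalue E (A + B ** N) z"
proof (rule ccontr)
  assume "\<not> pair_eigenvalue E (A + B ** N) z"
  then have "invertible (pencil z E A - B ** N)"
    by (auto simp: pair_eigenvalue_def pencil_add_right invertible_iff_ker)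
  then obtain X where "(pencil z E A - B ** N) ** X = mat 1" by (auto simp: invertible_def)
  moreover have "(pencil z E A - B ** N) ** X = pencil z E A ** X + B ** (- (N ** X))"
    by (simp add: bounded_bilinear.diff_left[OF bounded_bilinear_matrix_mult]
        bounded_bilinear.minus_right[OF bounded_bilinear_matrix_mult] matrix_mul_assoc)
  ultimately show False using assms controllable_iff by metis
qed

lemma unobservable_imp_feedback_eigenvalue:
  fixes E A :: "complex^'n^'n" and C :: "complex^'n^'m"
  assumes "unobservable_eigenvalue E A C z"
  shows "pair_eigenvalue E (A + N ** C) z"
proof -
  obtain v where "v \<noteq> 0" "pencil z E A *v v = 0" "C *v v = 0"
    using assms observable_iff by blast
  then show ?thesis
    unfolding pair_eigenvalue_def
    by (intro exI[of _ v]) (simp add: pencil_add_right matrix_vector_mult_diff_rdistrib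
        flip: matrix_vector_mul_assoc)
qed

text \<open>Keeps the multiplier and the gain built from \<open>M\<close> over \<open>F\<close>. For
  real data, \<open>G^-1(s)\<close> is real at all but finitely many real \<open>s\<close>, and
  \<open>M\<close> is a limit along the positive real axis, so it stays in the closed set
  \<open>\<real>\<close>.\<close>

lemma leading_coefficient_entries_in:
  fixes E A :: "complex^'n^'n" and B :: "complex^'m^'n"
    and C :: "complex^'n^'m" and D :: "complex^'m^'m" and G :: "ratfun^'m^'m"
  assumes F: "F = \<real> \<or> F = UNIV"
    and entries: "entries_in F E" "entries_in F A" "entries_in F B" "entries_in F C" "entries_in F D"
    and regular: "det (pencil rat_s (const_rat E) (const_rat A)) \<noteq> 0"
    and G: "G = transfer_function E A B C D"
    and invG: "invertible G"
    and M: "\<And>i j. ((\<lambda>s. s powi (-1) * rat_eval (matrix_inv G $ i $ j) s) \<longlongrightarrow> M $ i $ j) at_infinity"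
  shows "entries_in F M"
proof (cases "F = UNIV")
  case False
  then have FR: "F = \<real>" using F by simp
  have "\<forall>\<^sub>F s in cofinite. s \<in> \<real> \<longrightarrow> entries_in F (mat_eval (matrix_inv G) s)"
    using mat_eval_matrix_inv[OF invG] eventually_transfer_function[OF regular G]
  proof eventually_elim
    case (elim s)
    show ?case
    proof
      assume s: "s \<in> \<real>"
      have "entries_in F (pencil s E A)"
        using entries s by (simp add: entries_in_def pencil_def FR)
      then have "entries_in F (mat_eval G s)"
        using elim entries by (simp add: entries_in_add entries_in_mult entries_in_matrix_inv F)
      then show "entries_in F (mat_eval (matrix_inv G) s)"
        using elim by (simp add: entries_in_matrix_inv F)
    qed
  qed
  then have "\<forall>\<^sub>F t in at_top. complex_of_real t \<in> \<real> \<longrightarrow> entries_in F (mat_eval (matrix_inv G) (of_real t))"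
    by (rule eventually_compose_filterlim[OF eventually_cofinite_at_infinity filterlim_of_real_at_infinity])
  then have ev: "\<forall>\<^sub>F t in at_top. of_real t powi (-1) * rat_eval (matrix_inv G $ i $ j) (of_real t) \<in> \<real>" for i j
    by eventually_elim (auto simp: entries_in_def FR intro!: Reals_mult simp flip: of_real_power_int)
  have "M $ i $ j \<in> \<real>" for i j
    by (rule Lim_in_closed_set[OF closed_complex_Reals ev trivial_limit_at_top_linorder
          filterlim_compose[OF M filterlim_of_real_at_infinity]])
  then show ?thesis by (simp add: entries_in_def FR)
qed (simp add: entries_in_def)

text \<open>Subtracting \<open>s M\<close> leaves entries without poles in the half-plane that grow
  slower than \<open>s\<close>, hence are bounded there; the entrywise bounds are summed.\<close>

lemma ex_affine_approximation:
  fixes H :: "ratfun^'m^'m"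
  assumes poles: "\<And>z. finite_pole H z \<Longrightarrow> Re z < 0"
    and M: "\<And>i j. ((\<lambda>s. s powi (-1) * rat_eval (H $ i $ j) s) \<longlongrightarrow> M $ i $ j) at_infinity"
  obtains \<epsilon> b where "\<epsilon> > 0" "\<And>s. - \<epsilon> \<le> Re s \<Longrightarrow> \<not> finite_pole H s"
    "\<And>s. - \<epsilon> \<le> Re s \<Longrightarrow> norm (mat_eval H s - mat s ** M) \<le> b"
proof -
  obtain \<epsilon> where \<epsilon>: "\<epsilon> > 0" "\<And>s. - \<epsilon> \<le> Re s \<Longrightarrow> \<not> finite_pole H s"
    using finite_poles_margin[of H] poles by blast
  define R where "R i j = H $ i $ j - rat_s * to_fract [:M $ i $ j:]" for i j
  have ev: "rat_eval (R i j) s = rat_eval (H $ i $ j) s - s * M $ i $ j \<and> rat_regular (R i j) s"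
    if "\<not> finite_pole H s" for i j s
    using that by (simp add: R_def finite_pole_iff rat_eval_diff rat_eval_mult)
  have "\<exists>b. \<forall>s. - \<epsilon> \<le> Re s \<longrightarrow> norm (rat_eval (R i j) s) \<le> b" for i j
  proof -
    have "((\<lambda>s. s powi (-1) * rat_eval (H $ i $ j) s - M $ i $ j) \<longlongrightarrow> M $ i $ j - M $ i $ j) at_infinity"
      by (intro tendsto_intros M)
    then have "((\<lambda>s. s powi (-1) * rat_eval (R i j) s) \<longlongrightarrow> M $ i $ j - M $ i $ j) at_infinity"
    proof (rule Lim_transform_eventually)
      show "\<forall>\<^sub>F s in at_infinity. s powi (-1) * rat_eval (H $ i $ j) s - M $ i $ j = s powi (-1) * rat_eval (R i j) s"
        using eventually_cofinite_at_infinity[OF eventually_not_finite_pole[of H]] eventually_nonzero_at_infinity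
        by eventually_elim (simp add: ev power_int_minus field_simps)
    qed
    then have "((\<lambda>s. s powi (-1) * rat_eval (R i j) s) \<longlongrightarrow> 0) at_infinity" by simp
    moreover have "rat_regular (R i j) s" if "- \<epsilon> \<le> Re s" for s
      using ev \<epsilon>(2)[OF that] by blast
    ultimately show ?thesis using rat_bounded_on_half_plane[of \<epsilon> "R i j"] by metis
  qed
  then obtain b where b: "\<And>i j s. - \<epsilon> \<le> Re s \<Longrightarrow> norm (rat_eval (R i j) s) \<le> b i j" by metis
  have "norm (mat_eval H s - mat s ** M) \<le> (\<Sum>i\<in>UNIV. \<Sum>j\<in>UNIV. b i j)" if s: "- \<epsilon> \<le> Re s" for s
  proof -
    have "(mat_eval H s - mat s ** M) $ i $ j = rat_eval (R i j) s" for i j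
      using ev[OF \<epsilon>(2)[OF s]]
      by (simp add: matrix_matrix_mult_def mat_def if_distrib[where f = "\<lambda>x. x * _"] cong: if_cong)
    then show ?thesis using b[OF s] by (intro order_trans[OF norm_matrix_le_sum] sum_mono) simp
  qed
  with \<epsilon> show ?thesis by (rule that)
qed

lemma ex_stabilizing_spr_feedback:
  fixes E A :: "complex^'n^'n" and B :: "complex^'m^'n"
    and C :: "complex^'n^'m" and D :: "complex^'m^'m" and G :: "ratfun^'m^'m"
  assumes F: "F = \<real> \<or> F = UNIV"
    and entries: "entries_in F E" "entries_in F A" "entries_in F B" "entries_in F C" "entries_in F D"
    and regular: "det (pencil rat_s (const_rat E) (const_rat A)) \<noteq> 0"
    and G: "G = transfer_function E A B C D"
    and invG: "invertible G"
    and poles: "\<And>z. finite_pole (matrix_inv G) z \<Longrightarrow> Re z < 0"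
    and order: "\<And>i j. \<exists>l. ((\<lambda>s. s powi (-1) * rat_eval (matrix_inv G $ i $ j) s) \<longlongrightarrow> l) at_infinity"
    and con: "\<And>z. uncontrollable_eigenvalue E A B z \<Longrightarrow> Re z < 0"
    and obs: "\<And>z. unobservable_eigenvalue E A C z \<Longrightarrow> Re z < 0"
  obtains K L where "entries_in F K" "entries_in F L" "invertible (mat 1 - K ** D)"
    "stable_pair E (A + B ** matrix_inv (mat 1 - K ** D) ** K ** C)"
    "invertible (mat 1 - G ** const_rat K)"
    "strictly_positive_real (const_rat L ** matrix_inv (mat 1 - G ** const_rat K) ** G)"
proof -
  obtain m where m: "\<And>i j. ((\<lambda>s. s powi (-1) * rat_eval (matrix_inv G $ i $ j) s) \<longlongrightarrow> m i j) at_infinity"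
    using order by metis
  define M where "M = (\<chi> i j. m i j)"
  have M: "((\<lambda>s. s powi (-1) * rat_eval (matrix_inv G $ i $ j) s) \<longlongrightarrow> M $ i $ j) at_infinity" for i j
    using m by (simp only: M_def vec_lambda_beta)
  have "entries_in F M"
    using F entries regular G invG M by (rule leading_coefficient_entries_in)
  then obtain N Q :: "complex^'m^'m" where N: "entries_in F N" "invertible N" "M ** N = Q ** conj_transpose Q"
    by (rule ex_psd_multiplier[OF F])
  obtain \<epsilon> b where \<epsilon>: "\<epsilon> > 0" "\<And>s. - \<epsilon> \<le> Re s \<Longrightarrow> \<not> finite_pole (matrix_inv G) s"
    and b: "\<And>s. - \<epsilon> \<le> Re s \<Longrightarrow> norm (mat_eval (matrix_inv G) s - mat s ** M) \<le> b"
    using ex_affine_approximation[OF poles M] by blast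
  obtain \<beta> where \<beta>: "\<beta> > 0" "\<And>(R::complex^'m^'m) x. norm (R *v x) \<le> norm R * norm x * \<beta>"
    using bounded_bilinear.pos_bounded[OF bounded_bilinear_matrix_vector_mult] by blast
  obtain \<nu> where \<nu>: "\<nu> > 0" "\<And>x. norm (N *v x) \<le> \<nu> * norm x"
    using ex_matrix_vector_bound[of N] by metis
  obtain q where q: "q > 0" "\<And>x. norm (conj_transpose Q *v x) \<le> q * norm x"
    using ex_matrix_vector_bound[of "conj_transpose Q"] by metis
  define L where "L = matrix_inv N"
  have NL: "N ** L = mat 1" "L ** N = mat 1" by (simp_all add: L_def matrix_inv_invertible N(2))
  \<comment> \<open>\<open>\<epsilon> * q^2\<close> covers the loss from \<open>s M N\<close> where
    \<open>Re s\<close> is negative, and \<open>b * \<nu> * \<beta>\<close> covers the remainder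
    \<open>R N\<close>. The gain must also avoid the finitely many values that make
    \<open>I - K D\<close> singular.\<close>
  have "\<forall>\<^sub>F k in at_top. invertible (mat 1 + mat (of_real k) ** (L ** D)) \<and> \<epsilon> * q\<^sup>2 + b * \<nu> * \<beta> < k"
    by (intro eventually_conj eventually_invertible_affine eventually_gt_at_top)
  then obtain k where k: "invertible (mat 1 + mat (of_real k) ** (L ** D))" "\<epsilon> * q\<^sup>2 + b * \<nu> * \<beta> < k"
    using eventually_happens'[OF trivial_limit_at_top_linorder] by blast
  define K where "K = mat (of_real (- k)) ** L"
  have KN: "K ** N = mat (of_real (- k))" by (simp add: K_def NL flip: matrix_mul_assoc)
  \<comment> \<open>Serves twice: for the positivity of \<open>T\<close> and, at a supposed unstable
    eigenvalue \<open>z\<close>, for the invertibility of \<open>G^-1(z) - K\<close>.\<close>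
  have P_pos: "inner x (((mat_eval (matrix_inv G) s - K) ** N) *v x) > 0"
    if s: "- \<epsilon> \<le> Re s" and "x \<noteq> 0" for s x
  proof -
    define R where "R = mat_eval (matrix_inv G) s - mat s ** M"
    have "((mat_eval (matrix_inv G) s - K) ** N) *v x = R *v (N *v x) + s *s ((M ** N) *v x) - (K ** N) *v x"
      by (simp add: R_def matrix_vector_mult_diff_rdistrib mat_mult_vec flip: matrix_vector_mul_assoc)
    then have "((mat_eval (matrix_inv G) s - K) ** N) *v x
        = R *v (N *v x) + Q *v (s *s (conj_transpose Q *v x)) + of_real k *s x"
      by (simp add: N(3) KN mat_mult_vec vec.scale flip: matrix_vector_mul_assoc)
    then have eq: "inner x (((mat_eval (matrix_inv G) s - K) ** N) *v x) =
        inner x (R *v (N *v x)) + Re s * (norm (conj_transpose Q *v x))\<^sup>2 + k * (norm x)\<^sup>2"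
      by (simp add: inner_add_right inner_smult flip: inner_conj_transpose)
    have "norm (R *v (N *v x)) \<le> b * (\<nu> * norm x) * \<beta>"
    proof -
      have "norm (R *v (N *v x)) \<le> norm R * norm (N *v x) * \<beta>" by (rule \<beta>)
      also have "\<dots> \<le> b * (\<nu> * norm x) * \<beta>"
        using b[OF s] \<beta>(1) \<nu> by (intro mult_right_mono mult_mono) (auto simp: R_def intro: order_trans[OF norm_ge_zero])
      finally show ?thesis .
    qed
    then have "\<bar>inner x (R *v (N *v x))\<bar> \<le> norm x * (b * (\<nu> * norm x) * \<beta>)"
      by (intro order_trans[OF Cauchy_Schwarz_ineq2] mult_left_mono) auto
    also have "\<dots> = b * \<nu> * \<beta> * (norm x)\<^sup>2" by (simp add: power2_eq_square)
    finally have 1: "- (b * \<nu> * \<beta> * (norm x)\<^sup>2) \<le> inner x (R *v (N *v x))" by linarith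
    have "(norm (conj_transpose Q *v x))\<^sup>2 \<le> q\<^sup>2 * (norm x)\<^sup>2"
      using power_mono[OF q(2) norm_ge_zero, of x 2] by (simp add: power_mult_distrib)
    then have "\<epsilon> * (norm (conj_transpose Q *v x))\<^sup>2 \<le> \<epsilon> * (q\<^sup>2 * (norm x)\<^sup>2)"
      using \<epsilon>(1) by (intro mult_left_mono) auto
    moreover have "- \<epsilon> * (norm (conj_transpose Q *v x))\<^sup>2 \<le> Re s * (norm (conj_transpose Q *v x))\<^sup>2"
      using s by (intro mult_right_mono) auto
    ultimately have 2: "- (\<epsilon> * q\<^sup>2 * (norm x)\<^sup>2) \<le> Re s * (norm (conj_transpose Q *v x))\<^sup>2" by simp
    have "(\<epsilon> * q\<^sup>2 + b * \<nu> * \<beta>) * (norm x)\<^sup>2 < k * (norm x)\<^sup>2"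
      using k(2) \<open>x \<noteq> 0\<close> by (intro mult_strict_right_mono) auto
    with 1 2 show ?thesis by (simp add: eq distrib_right)
  qed
  define P where "P = (matrix_inv G - const_rat K) ** const_rat N"
  have P: "mat_eval P s = (mat_eval (matrix_inv G) s - K) ** N" "\<not> finite_pole P s" if "- \<epsilon> \<le> Re s" for s
    using \<epsilon>(2)[OF that] by (simp_all add: P_def mat_eval_mult mat_eval_diff)
  have invPs: "invertible (mat_eval P s)" if "- \<epsilon> \<le> Re s" for s
    unfolding invertible_iff_ker P(1)[OF that] using P_pos[OF that] by (metis inner_zero_right less_irrefl)
  have invP: "invertible P" using \<epsilon>(1) by (rule invertible_ratmat_half_planeI) (simp add: invPs)
  have NLr: "const_rat N ** const_rat L = mat 1" "const_rat L ** const_rat N = mat 1"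
    by (simp_all add: const_rat_mult NL const_rat_mat_1)
  have "P ** const_rat L = (matrix_inv G - const_rat K) ** (const_rat N ** const_rat L)"
    unfolding P_def by (rule matrix_mul_assoc[symmetric])
  then have PL: "P ** const_rat L = matrix_inv G - const_rat K" by (simp add: NLr)
  \<comment> \<open>Since \<open>I - G K = G (G^-1 - K) = G P L\<close>, invertibility of the loop
    comes from that of \<open>P\<close>.\<close>
  define J where "J = mat 1 - G ** const_rat K"
  have J: "J = G ** (P ** const_rat L)"
  proof -
    have "G ** (matrix_inv G - const_rat K) + G ** const_rat K = G ** matrix_inv G"
      by (simp flip: matrix_add_ldistrib)
    then show ?thesis by (simp add: PL J_def matrix_inv_invertible invG eq_diff_eq diff_eq_eq)
  qed
  have invJ: "invertible J"
    unfolding J using invG invP NLr by (intro invertible_mult) (auto simp: invertible_def)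
  define T where "T = const_rat L ** matrix_inv J ** G"
  have "T ** P = T ** P ** (const_rat L ** const_rat N)" by (simp add: NLr)
  also have "\<dots> = const_rat L ** (matrix_inv J ** J) ** const_rat N"
    by (simp add: T_def J matrix_mul_assoc)
  also have "\<dots> = mat 1" by (simp add: matrix_inv_invertible invJ NLr)
  finally have TP: "T ** P = mat 1" .
  have spr: "strictly_positive_real T"
    unfolding strictly_positive_real_def pos_definite_hermitian_part_iff
  proof (intro exI[of _ \<epsilon>] conjI allI impI)
    fix s x assume s: "- \<epsilon> \<le> Re s \<and> \<not> finite_pole T s" and x: "(x::complex^'m) \<noteq> 0"
    have TPs: "mat_eval T s ** mat_eval P s = mat 1"
      using mat_eval_mult(1)[of T s P] s P(2) by (simp add: TP)
    define y where "y = mat_eval T s *v x"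
    have y: "mat_eval P s *v y = x"
      using TPs by (simp add: y_def matrix_vector_mul_assoc matrix_left_right_inverse[of "mat_eval T s"])
    then have "y \<noteq> 0" using x by auto
    then have "0 < inner y (mat_eval P s *v y)" using P_pos P(1) s by simp
    then show "0 < inner x (mat_eval T s *v x)" by (simp add: y inner_commute flip: y_def)
  qed (rule \<epsilon>)
  have invKD: "invertible (mat 1 - K ** D)"
  proof -
    have "mat 1 - K ** D = mat 1 + mat (of_real k) ** (L ** D)"
      by (simp add: K_def matrix_eq matrix_vector_mult_diff_rdistrib matrix_vector_mult_add_rdistrib mat_mult_vec
          flip: matrix_vector_mul_assoc)
    with k(1) show ?thesis by (simp only:)
  qed
  have stable: "stable_pair E (A + B ** matrix_inv (mat 1 - K ** D) ** K ** C)"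
    unfolding stable_pair_def
  proof (intro allI impI, rule ccontr)
    fix z assume ev: "pair_eigenvalue E (A + B ** matrix_inv (mat 1 - K ** D) ** K ** C) z" and "\<not> Re z < 0"
    then have z: "0 \<le> Re z" "- \<epsilon> \<le> Re z" using \<epsilon>(1) by auto
    have "\<not> uncontrollable_eigenvalue E A B z" "\<not> unobservable_eigenvalue E A C z"
      using con[of z] obs[of z] \<open>\<not> Re z < 0\<close> by auto
    moreover have "invertible (mat_eval (matrix_inv G) z - K)"
      using invPs[OF z(2)] unfolding P(1)[OF z(2)] by (rule invertible_factors)
    ultimately show False
      using not_closed_loop_eigenvalue[OF regular G invG invKD _ _ \<epsilon>(2)[OF z(2)]] ev by blast
  qed
  have "entries_in F L" unfolding L_def using F N(1,2) by (rule entries_in_matrix_inv)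
  moreover from this have "entries_in F K"
    unfolding K_def by (intro entries_in_mult[OF F] entries_in_mat_of_real[OF F])
  ultimately show ?thesis
    using that invKD stable invJ spr unfolding J_def T_def by blast
qed

theorem theorem2:
  fixes F :: "complex set"
    and E A :: "complex^'n^'n" and B :: "complex^'m^'n"
    and C :: "complex^'n^'m" and D :: "complex^'m^'m"
    and G :: "ratfun^'m^'m"
  assumes F: "F = \<real> \<or> F = UNIV"
    and entries: "entries_in F E" "entries_in F A" "entries_in F B" "entries_in F C" "entries_in F D"
    and regular: "det (pencil rat_s (const_rat E) (const_rat A)) \<noteq> 0"
    and G: "G = transfer_function E A B C D"
  shows "(\<exists>K L :: complex^'m^'m. entries_in F K \<and> entries_in F L \<and>
            invertible (mat 1 - K ** D) \<and>
            stable_pair E (A + B ** matrix_inv (mat 1 - K ** D) ** K ** C) \<and>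
            invertible (mat 1 - G ** const_rat K) \<and>
            strictly_positive_real
              (const_rat L ** matrix_inv (mat 1 - G ** const_rat K) ** G))
     \<longleftrightarrow>
         (invertible G \<and>
          (\<forall>z. finite_pole (matrix_inv G) z \<longrightarrow> Re z < 0) \<and>
          (pole_at_infinity (matrix_inv G) \<longrightarrow> pole_order_infinity (matrix_inv G) = 1) \<and>
          (\<forall>z. uncontrollable_eigenvalue E A B z \<longrightarrow> Re z < 0) \<and>
          (\<forall>z. unobservable_eigenvalue E A C z \<longrightarrow> Re z < 0))"
  \<comment> \<open>Condition (b) becomes convergence of the entries of \<open>s^-1 G^-1(s)\<close>
    at infinity, which includes the case without a pole and is what both implications work
    with.\<close>
  unfolding pole_order_infinity_le_1_iff
proof
  assume "\<exists>K L :: complex^'m^'m. entries_in F K \<and> entries_in F L \<and>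
            invertible (mat 1 - K ** D) \<and>
            stable_pair E (A + B ** matrix_inv (mat 1 - K ** D) ** K ** C) \<and>
            invertible (mat 1 - G ** const_rat K) \<and>
            strictly_positive_real
              (const_rat L ** matrix_inv (mat 1 - G ** const_rat K) ** G)"
  then obtain K L :: "complex^'m^'m" where
    stable: "stable_pair E (A + B ** matrix_inv (mat 1 - K ** D) ** K ** C)" and
    inv: "invertible (mat 1 - G ** const_rat K)" and
    spr: "strictly_positive_real (const_rat L ** matrix_inv (mat 1 - G ** const_rat K) ** G)"
    by blast
  have "Re z < 0" if "uncontrollable_eigenvalue E A B z" for z
    using stable uncontrollable_imp_feedback_eigenvalue[OF that, of "matrix_inv (mat 1 - K ** D) ** K ** C"]
    by (simp add: stable_pair_def matrix_mul_assoc)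
  moreover have "Re z < 0" if "unobservable_eigenvalue E A C z" for z
    using stable unobservable_imp_feedback_eigenvalue[OF that] by (simp add: stable_pair_def)
  moreover have "Re z < 0" if "finite_pole (matrix_inv G) z" for z
    using spr_closed_loop_imp_inverse(2)[OF inv spr, of z] that by force
  ultimately show "invertible G \<and> (\<forall>z. finite_pole (matrix_inv G) z \<longrightarrow> Re z < 0) \<and>
      (\<forall>i j. \<exists>l. ((\<lambda>s. s powi (-1) * rat_eval (matrix_inv G $ i $ j) s) \<longlongrightarrow> l) at_infinity) \<and>
      (\<forall>z. uncontrollable_eigenvalue E A B z \<longrightarrow> Re z < 0) \<and>
      (\<forall>z. unobservable_eigenvalue E A C z \<longrightarrow> Re z < 0)"
    using spr_closed_loop_imp_inverse(1,3)[OF inv spr] by blast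
next
  assume "invertible G \<and> (\<forall>z. finite_pole (matrix_inv G) z \<longrightarrow> Re z < 0) \<and>
      (\<forall>i j. \<exists>l. ((\<lambda>s. s powi (-1) * rat_eval (matrix_inv G $ i $ j) s) \<longlongrightarrow> l) at_infinity) \<and>
      (\<forall>z. uncontrollable_eigenvalue E A B z \<longrightarrow> Re z < 0) \<and>
      (\<forall>z. unobservable_eigenvalue E A C z \<longrightarrow> Re z < 0)"
  then obtain K L where "entries_in F K" "entries_in F L" "invertible (mat 1 - K ** D)"
    "stable_pair E (A + B ** matrix_inv (mat 1 - K ** D) ** K ** C)"
    "invertible (mat 1 - G ** const_rat K)"
    "strictly_positive_real (const_rat L ** matrix_inv (mat 1 - G ** const_rat K) ** G)"
    using ex_stabilizing_spr_feedback[OF F entries regular G] by blast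
  then show "\<exists>K L :: complex^'m^'m. entries_in F K \<and> entries_in F L \<and>
            invertible (mat 1 - K ** D) \<and>
            stable_pair E (A + B ** matrix_inv (mat 1 - K ** D) ** K ** C) \<and>
            invertible (mat 1 - G ** const_rat K) \<and>
            strictly_positive_real
              (const_rat L ** matrix_inv (mat 1 - G ** const_rat K) ** G)"
    by blast
qed

end
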